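(* Let $\mathbf r:U\to\mathbb R^3$ be a pseudospherical surface in Dini's parameterisation with Chebyshev angle $\phi$ and unit normal $\mathbf n$, and let $\Psi$ be a solution of $\Psi_{xy}=\Psi\cos\phi$. The recursion operator $(\mathcal R+\mathrm{Id})^{-1}$ can be written in the form $$(\mathcal R+\mathrm{Id})^{-1}\Psi=\mathbf n\cdot\mathbf q,$$ where the vector function $\mathbf q:U\to\mathbb R^3$ is obtained by the quadratures $$\mathbf q_x=\frac{\mathbf r_y}{\sin\phi}\Big(\frac{\phi_x}{\sin\phi}\Psi_y-\Psi\Big),\qquad \mathbf q_y=\frac{\mathbf r_x}{\sin\phi}\Big(\frac{\phi_y}{\tan\phi}\Psi_y-\Psi_{yy}\Big).$$ That is, the values of $(\mathcal R+\mathrm{Id})^{-1}$ on $\Psi$ are exactly the functions $\mathbf n\cdot\mathbf q$ with $\mathbf q$ a solution of this (compatible) system.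
   Context: All functions are smooth; $U\subset\mathbb R^2$ is a connected, simply connected open set with coordinates $x,y$. A pseudospherical surface in Dini's parameterisation with Chebyshev angle $\phi$ is a map $\mathbf r:U\to\mathbb R^3$ with unit normal $\mathbf n$ whose fundamental forms are $\mathrm I=dx^2+2\cos\phi\,dx\,dy+dy^2$, $\mathrm{II}=2\sin\phi\,dx\,dy$, where $\sin\phi\neq0$ on $U$. Equivalently, $\phi_{xy}=\sin\phi$ and $$\mathbf r_{xx}=\tfrac{\phi_x}{\tan\phi}\mathbf r_x-\tfrac{\phi_x}{\sin\phi}\mathbf r_y,\quad \mathbf r_{xy}=\sin\phi\,\mathbf n,\quad \mathbf r_{yy}=-\tfrac{\phi_y}{\sin\phi}\mathbf r_x+\tfrac{\phi_y}{\tan\phi}\mathbf r_y,$$ $$\mathbf n_x=\tfrac1{\tan\phi}\mathbf r_x-\tfrac1{\sin\phi}\mathbf r_y,\quad \mathbf n_y=\tfrac1{\tan\phi}\mathbf r_y-\tfrac1{\sin\phi}\mathbf r_x .$$ $\mathcal R$ is the multivalued recursion operator acting on solutions $\Phi$ of $\Phi_{xy}=\Phi\cos\phi$ by $\mathcal R\Phi=\Phi_{xx}+\phi_xQ$, where $Q$ is any function with $Q_x=\Phi_x\phi_x$, $Q_y=\Phi\sin\phi$. The inverse is taken in the sense of relations: $\Phi$ is a value of $(\mathcal R+\mathrm{Id})^{-1}\Psi$ if $\Phi_{xy}=\Phi\cos\phi$ and $\Psi=\Phi_{xx}+\phi_xQ+\Phi$ for some $Q$ with $Q_x=\Phi_x\phi_x$,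 $Q_y=\Phi\sin\phi$. *)

theory Defs
  imports "HOL-Analysis.Analysis"
begin

text \<open>
  \<open>C\<^sup>k\<close> maps on an open set: \<open>f\<close> is Frechet differentiable and every directional
  derivative is \<open>C\<^sup>k\<^sup>-\<^sup>1\<close>. In finite-dimensional domains this is the usual notion.
\<close>

primrec Ck_on :: "nat \<Rightarrow> 'a::real_normed_vector set \<Rightarrow> ('a \<Rightarrow> 'b::real_normed_vector) \<Rightarrow> bool"
where
  "Ck_on 0 S f \<longleftrightarrow> continuous_on S f"
| "Ck_on (Suc k) S f \<longleftrightarrow>
     (\<forall>p\<in>S. f differentiable (at p)) \<and>
     (\<forall>v. Ck_on k S (\<lambda>p. frechet_derivative f (at p) v))"

definition smooth_on :: "'a::real_normed_vector set \<Rightarrow> ('a \<Rightarrow> 'b::real_normed_vector) \<Rightarrow> bool" where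
  "smooth_on S f \<longleftrightarrow> (\<forall>k. Ck_on k S f)"

definition pdx :: "(real \<times> real \<Rightarrow> 'b::real_normed_vector) \<Rightarrow> real \<times> real \<Rightarrow> 'b" where
  "pdx f p = frechet_derivative f (at p) (1, 0)"

definition pdy :: "(real \<times> real \<Rightarrow> 'b::real_normed_vector) \<Rightarrow> real \<times> real \<Rightarrow> 'b" where
  "pdy f p = frechet_derivative f (at p) (0, 1)"

text \<open>
  Functions below are total, but only their values on the open set \<open>U\<close> matter.
  In \<open>dini_surface\<close>, the equations say \<open>n\<close> is a unit normal of \<open>r\<close>,
  \<open>I = dx\<^sup>2 + 2 cos \<phi> dx dy + dy\<^sup>2\<close> and \<open>II = 2 sin \<phi> dx dy\<close>, where the coefficients of
  \<open>II\<close> are the normal components of the second derivatives of \<open>r\<close>. The sign of \<open>II\<close> fixes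
  which of the two unit normals is meant. The Gauss-Weingarten equations and
  \<open>\<phi>\<^sub>x\<^sub>y = sin \<phi>\<close> are consequences and are not assumed.
\<close>

definition dini_surface ::
  "(real \<times> real) set \<Rightarrow> (real \<times> real \<Rightarrow> real) \<Rightarrow> (real \<times> real \<Rightarrow> real^3) \<Rightarrow>
   (real \<times> real \<Rightarrow> real^3) \<Rightarrow> bool"
where
  "dini_surface U \<phi> r n \<longleftrightarrow>
     smooth_on U \<phi> \<and> smooth_on U r \<and> smooth_on U n \<and>
     (\<forall>p\<in>U. sin (\<phi> p) \<noteq> 0 \<and>
        n p \<bullet> n p = 1 \<and> n p \<bullet> pdx r p = 0 \<and> n p \<bullet> pdy r p = 0 \<and>
        pdx r p \<bullet> pdx r p = 1 \<and>
        pdx r p \<bullet> pdy r p = cos (\<phi> p) \<and>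
        pdy r p \<bullet> pdy r p = 1 \<and>
        n p \<bullet> pdx (pdx r) p = 0 \<and>
        n p \<bullet> pdy (pdx r) p = sin (\<phi> p) \<and>
        n p \<bullet> pdy (pdy r) p = 0)"

definition lin_solutions ::
  "(real \<times> real) set \<Rightarrow> (real \<times> real \<Rightarrow> real) \<Rightarrow> (real \<times> real \<Rightarrow> real) set"
where
  "lin_solutions U \<phi> =
     {\<Phi>. smooth_on U \<Phi> \<and> (\<forall>p\<in>U. pdy (pdx \<Phi>) p = \<Phi> p * cos (\<phi> p))}"

definition recursion_values ::
  "(real \<times> real) set \<Rightarrow> (real \<times> real \<Rightarrow> real) \<Rightarrow> (real \<times> real \<Rightarrow> real) \<Rightarrow>
   (real \<times> real \<Rightarrow> real) set"
where
  "recursion_values U \<phi> \<Phi> =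
     {X. \<exists>Q. smooth_on U Q \<and>
          (\<forall>p\<in>U. pdx Q p = pdx \<Phi> p * pdx \<phi> p \<and> pdy Q p = \<Phi> p * sin (\<phi> p)) \<and>
          (\<forall>p\<in>U. X p = pdx (pdx \<Phi>) p + pdx \<phi> p * Q p)}"

text \<open>The inverse of the multivalued operator \<open>R + Id\<close>, as a relation.\<close>

definition recursion_plus_id_inverse ::
  "(real \<times> real) set \<Rightarrow> (real \<times> real \<Rightarrow> real) \<Rightarrow> (real \<times> real \<Rightarrow> real) \<Rightarrow>
   (real \<times> real \<Rightarrow> real) set"
where
  "recursion_plus_id_inverse U \<phi> \<Psi> =
     {\<Phi> \<in> lin_solutions U \<phi>. \<exists>X\<in>recursion_values U \<phi> \<Phi>. \<forall>p\<in>U. \<Psi> p = X p + \<Phi> p}"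

definition quad_x ::
  "(real \<times> real \<Rightarrow> real) \<Rightarrow> (real \<times> real \<Rightarrow> real^3) \<Rightarrow> (real \<times> real \<Rightarrow> real) \<Rightarrow>
   real \<times> real \<Rightarrow> real^3"
where
  "quad_x \<phi> r \<Psi> p =
     (pdx \<phi> p / sin (\<phi> p) * pdy \<Psi> p - \<Psi> p) *\<^sub>R (pdy r p /\<^sub>R sin (\<phi> p))"

text \<open>
  The quotient by \<open>tan \<phi>\<close> is written with \<open>cot \<phi> = cos \<phi> / sin \<phi>\<close>, which is the intended
  reading also at points where \<open>cos \<phi> = 0\<close>.
\<close>

definition quad_y ::
  "(real \<times> real \<Rightarrow> real) \<Rightarrow> (real \<times> real \<Rightarrow> real^3) \<Rightarrow> (real \<times> real \<Rightarrow> real) \<Rightarrow>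
   real \<times> real \<Rightarrow> real^3"
where
  "quad_y \<phi> r \<Psi> p =
     (pdy \<phi> p * cot (\<phi> p) * pdy \<Psi> p - pdy (pdy \<Psi>) p) *\<^sub>R (pdx r p /\<^sub>R sin (\<phi> p))"

definition quadrature_solutions ::
  "(real \<times> real) set \<Rightarrow> (real \<times> real \<Rightarrow> real) \<Rightarrow> (real \<times> real \<Rightarrow> real^3) \<Rightarrow>
   (real \<times> real \<Rightarrow> real) \<Rightarrow> (real \<times> real \<Rightarrow> real^3) set"
where
  "quadrature_solutions U \<phi> r \<Psi> =
     {q. smooth_on U q \<and> (\<forall>p\<in>U. pdx q p = quad_x \<phi> r \<Psi> p \<and> pdy q p = quad_y \<phi> r \<Psi> p)}"

end

theory Submission
  imports Defs "HOL-Complex_Analysis.Riemann_Mapping"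
begin

text \<open>
  The vectors \<open>n\<close>, \<open>n\<^sub>x\<close>, \<open>r\<^sub>x\<close> form an orthonormal frame with \<open>n\<^sub>x\<^sub>x = - n - \<phi>\<^sub>x r\<^sub>x\<close>,
  \<open>n\<^sub>x\<^sub>y = cos \<phi> n\<close> and \<open>r\<^sub>x\<^sub>x = \<phi>\<^sub>x n\<^sub>x\<close>. If \<open>q\<close> solves the quadratures and \<open>\<Phi> = n \<bullet> q\<close>, then
  \<open>\<Phi>\<^sub>x = n\<^sub>x \<bullet> q\<close>, and \<open>Q = r\<^sub>x \<bullet> q + \<Psi>\<^sub>y / sin \<phi>\<close> is a potential witnessing \<open>(R + Id) \<Phi> = \<Psi>\<close>.
  Reading these relations backwards, a value \<open>\<Phi>\<close> with potential \<open>Q\<close> comes from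
  \<open>q = \<Phi> n + \<Phi>\<^sub>x n\<^sub>x + (Q - \<Psi>\<^sub>y / sin \<phi>) r\<^sub>x\<close>. Existence of \<open>q\<close> is the Poincare lemma on the
  simply connected \<open>U\<close>, reduced to a convex domain by the Riemann mapping theorem.
\<close>

section \<open>Calculus of \<open>C\<^sup>k\<close> maps\<close>

text \<open>On an open set a derivative depends only on nearby values, so each derivative of
  \<open>g\<close> agrees with that of \<open>f\<close> on \<open>S\<close> and the induction passes
  to directional derivatives. Total functions may thus be altered freely outside
  \<open>S\<close>.\<close>

lemma Ck_on_cong:
  assumes "open S" "\<And>p. p \<in> S \<Longrightarrow> f p = g p" "Ck_on k S f"
  shows "Ck_on k S g"
  using assms(2,3)
proof (induction k arbitrary: f g)
  case 0
  then show ?case by (simp cong: continuous_on_cong)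
next
  case (Suc k)
  have fd: "f differentiable at p" if "p \<in> S" for p
    using Suc.prems that by simp
  have "(g has_derivative frechet_derivative f (at p)) (at p)" if "p \<in> S" for p
    using fd[OF that] \<open>open S\<close> that Suc.prems(1)
    by (meson frechet_derivative_works has_derivative_transform_within_open)
  then have "g differentiable at p \<and> frechet_derivative g (at p) = frechet_derivative f (at p)"
    if "p \<in> S" for p
    using that by (metis differentiableI frechet_derivative_at)
  then show ?case
    using Suc.prems(2) by (auto intro: Suc.IH)
qed

lemma Ck_on_Suc_D: "Ck_on (Suc k) S f \<Longrightarrow> Ck_on k S f"
proof (induction k arbitrary: f)
  case 0
  then show ?case
    by (auto intro!: continuous_at_imp_continuous_on differentiable_imp_continuous_within)
next
  case (Suc k)
  then show ?case by (metis Ck_on.simps(2))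
qed

lemma Ck_on_const: "Ck_on k S (\<lambda>p. c)"
  by (induction k arbitrary: c) auto

text \<open>Replaces \<open>frechet_derivative\<close> by an explicitly known derivative, so that
  the usual differentiation rules drive the inductions on the order.\<close>

lemma Ck_on_SucI:
  assumes "open S"
    and "\<And>p. p \<in> S \<Longrightarrow> (f has_derivative f' p) (at p)"
    and "\<And>v. Ck_on k S (\<lambda>p. f' p v)"
  shows "Ck_on (Suc k) S f"
proof -
  have "frechet_derivative f (at p) = f' p" if "p \<in> S" for p
    using assms(2)[OF that] by (metis frechet_derivative_at)
  moreover have "f differentiable at p" if "p \<in> S" for p
    using assms(2)[OF that] differentiableI by blast
  ultimately show ?thesis
    using assms by (auto intro: Ck_on_cong)
qed

lemma Ck_on_has_derivative:
  "Ck_on (Suc k) S f \<Longrightarrow> p \<in> S \<Longrightarrow> (f has_derivative frechet_derivative f (at p)) (at p)"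
  by (simp add: frechet_derivative_works)

lemma Ck_on_add:
  assumes "open S" "Ck_on k S f" "Ck_on k S g"
  shows "Ck_on k S (\<lambda>p. f p + g p)"
  using assms(2,3)
proof (induction k arbitrary: f g)
  case 0
  then show ?case by (auto intro: continuous_intros)
next
  case (Suc k)
  show ?case
  proof (rule Ck_on_SucI[OF \<open>open S\<close>])
    show "((\<lambda>p. f p + g p) has_derivative
        (\<lambda>v. frechet_derivative f (at p) v + frechet_derivative g (at p) v)) (at p)" if "p \<in> S" for p
      using Suc.prems that by (blast intro: has_derivative_add Ck_on_has_derivative)
  qed (use Suc in auto)
qed

text \<open>By the Leibniz rule the derivative is a sum of two products of the same kind, each
  pairing a factor with a derivative. The undifferentiated factor is first lowered by one order, and
  then the induction hypothesis covers both products.\<close>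

lemma (in bounded_bilinear) Ck_on_prod:
  assumes "open S" "Ck_on k S f" "Ck_on k S g"
  shows "Ck_on k S (\<lambda>p. prod (f p) (g p))"
  using assms(2,3)
proof (induction k arbitrary: f g)
  case 0
  then show ?case by (auto intro: continuous_on)
next
  case (Suc k)
  show ?case
  proof (rule Ck_on_SucI[OF \<open>open S\<close>])
    show "((\<lambda>p. prod (f p) (g p)) has_derivative
        (\<lambda>v. prod (f p) (frechet_derivative g (at p) v) + prod (frechet_derivative f (at p) v) (g p)))
        (at p)" if "p \<in> S" for p
      using Suc.prems that by (intro FDERIV Ck_on_has_derivative)
    fix v
    show "Ck_on k S (\<lambda>p. prod (f p) (frechet_derivative g (at p) v) +
        prod (frechet_derivative f (at p) v) (g p))"
      using Suc.prems Suc.IH Ck_on_Suc_D[OF Suc.prems(1)] Ck_on_Suc_D[OF Suc.prems(2)]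
      by (intro Ck_on_add[OF \<open>open S\<close>]) auto
  qed
qed

lemmas Ck_on_mult = bounded_bilinear.Ck_on_prod[OF bounded_bilinear_mult]
lemmas Ck_on_scaleR = bounded_bilinear.Ck_on_prod[OF bounded_bilinear_scaleR]

text \<open>The two claims are proved together because the derivative of either function involves
  the other.\<close>

lemma Ck_on_sin_cos:
  fixes f :: "'a::real_normed_vector \<Rightarrow> real"
  assumes "open S" "Ck_on k S f"
  shows "Ck_on k S (\<lambda>p. sin (f p)) \<and> Ck_on k S (\<lambda>p. cos (f p))"
  using assms(2)
proof (induction k)
  case 0
  then show ?case by (auto intro: continuous_intros)
next
  case (Suc k)
  have d: "(f has_derivative frechet_derivative f (at p)) (at p)" if "p \<in> S" for p
    using Suc.prems that by (rule Ck_on_has_derivative)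
  have f': "Ck_on k S (\<lambda>p. frechet_derivative f (at p) v)" for v
    using Suc.prems by simp
  have IH: "Ck_on k S (\<lambda>p. sin (f p))" "Ck_on k S (\<lambda>p. cos (f p))"
    using Suc.IH[OF Ck_on_Suc_D[OF Suc.prems]] by auto
  have "Ck_on (Suc k) S (\<lambda>p. sin (f p))"
  proof (rule Ck_on_SucI[OF \<open>open S\<close>])
    show "((\<lambda>p. sin (f p)) has_derivative (\<lambda>v. frechet_derivative f (at p) v * cos (f p))) (at p)"
      if "p \<in> S" for p
      using d[OF that] by (rule has_derivative_sin)
  qed (intro Ck_on_mult \<open>open S\<close> f' IH)
  moreover have "Ck_on (Suc k) S (\<lambda>p. cos (f p))"
  proof (rule Ck_on_SucI[OF \<open>open S\<close>])
    show "((\<lambda>p. cos (f p)) has_derivative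
        (\<lambda>v. frechet_derivative f (at p) v * (- 1 * sin (f p)))) (at p)"
      if "p \<in> S" for p
      using has_derivative_cos[OF d[OF that]] by simp
  qed (intro Ck_on_mult \<open>open S\<close> f' IH Ck_on_const)
  ultimately show ?case ..
qed

text \<open>The derivative of the reciprocal is a product of a derivative of \<open>f\<close> with
  two copies of the reciprocal, which is one order smoother than needed only by the induction
  hypothesis.\<close>

lemma Ck_on_inverse:
  fixes f :: "'a::real_normed_vector \<Rightarrow> real"
  assumes "open S" "\<And>p. p \<in> S \<Longrightarrow> f p \<noteq> 0" "Ck_on k S f"
  shows "Ck_on k S (\<lambda>p. inverse (f p))"
  using assms(3)
proof (induction k)
  case 0
  then show ?case using assms(2) by (auto intro: continuous_intros)
next
  case (Suc k)
  have IH: "Ck_on k S (\<lambda>p. inverse (f p))"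
    using Suc.IH[OF Ck_on_Suc_D[OF Suc.prems]] .
  show ?case
  proof (rule Ck_on_SucI[OF \<open>open S\<close>])
    show "((\<lambda>p. inverse (f p)) has_derivative
        (\<lambda>v. -1 * (inverse (f p) * frechet_derivative f (at p) v * inverse (f p)))) (at p)"
      if "p \<in> S" for p
      using Deriv.has_derivative_inverse[OF assms(2)[OF that] Ck_on_has_derivative[OF Suc.prems that]]
      by simp
    next
    fix v
    have "Ck_on k S (\<lambda>p. frechet_derivative f (at p) v)"
      using Suc.prems by simp
    then show "Ck_on k S (\<lambda>p. -1 * (inverse (f p) * frechet_derivative f (at p) v * inverse (f p)))"
      by (intro Ck_on_mult \<open>open S\<close> IH Ck_on_const)
  qed
qed

section \<open>Closure properties of smooth maps\<close>

lemma smooth_on_cong: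
  "open S \<Longrightarrow> smooth_on S f \<Longrightarrow> (\<And>p. p \<in> S \<Longrightarrow> g p = f p) \<Longrightarrow> smooth_on S g"
  unfolding smooth_on_def by (metis Ck_on_cong)

lemma smooth_on_const: "smooth_on S (\<lambda>p. c)"
  by (simp add: smooth_on_def Ck_on_const)

lemma smooth_on_add:
  "open S \<Longrightarrow> smooth_on S f \<Longrightarrow> smooth_on S g \<Longrightarrow> smooth_on S (\<lambda>p. f p + g p)"
  by (simp add: smooth_on_def Ck_on_add)

lemma smooth_on_scaleR:
  "open S \<Longrightarrow> smooth_on S f \<Longrightarrow> smooth_on S g \<Longrightarrow> smooth_on S (\<lambda>p. f p *\<^sub>R g p)"
  by (simp add: smooth_on_def Ck_on_scaleR)

lemma smooth_on_mult:
  fixes f g :: "'a::real_normed_vector \<Rightarrow> real"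
  shows "open S \<Longrightarrow> smooth_on S f \<Longrightarrow> smooth_on S g \<Longrightarrow> smooth_on S (\<lambda>p. f p * g p)"
  by (simp add: smooth_on_def Ck_on_mult)

lemma smooth_on_inner:
  "open S \<Longrightarrow> smooth_on S f \<Longrightarrow> smooth_on S g \<Longrightarrow> smooth_on S (\<lambda>p. f p \<bullet> g p)"
  by (simp add: smooth_on_def bounded_bilinear.Ck_on_prod[OF bounded_bilinear_inner])

lemma smooth_on_minus: "open S \<Longrightarrow> smooth_on S f \<Longrightarrow> smooth_on S (\<lambda>p. - f p)"
  using smooth_on_scaleR[OF _ smooth_on_const[of S "-1"], of f] by simp

lemma smooth_on_diff:
  "open S \<Longrightarrow> smooth_on S f \<Longrightarrow> smooth_on S g \<Longrightarrow> smooth_on S (\<lambda>p. f p - g p)"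
  using smooth_on_add[OF _ _ smooth_on_minus, of S f g] by simp

lemma smooth_on_sin: "open S \<Longrightarrow> smooth_on S f \<Longrightarrow> smooth_on S (\<lambda>p. sin (f p :: real))"
  and smooth_on_cos: "open S \<Longrightarrow> smooth_on S f \<Longrightarrow> smooth_on S (\<lambda>p. cos (f p :: real))"
  by (simp_all add: smooth_on_def Ck_on_sin_cos)

lemma smooth_on_divide:
  fixes f g :: "'a::real_normed_vector \<Rightarrow> real"
  assumes "open S" "smooth_on S f" "smooth_on S g" "\<And>p. p \<in> S \<Longrightarrow> g p \<noteq> 0"
  shows "smooth_on S (\<lambda>p. f p / g p)"
  using assms unfolding divide_inverse
  by (intro smooth_on_mult) (simp_all add: smooth_on_def Ck_on_inverse)

lemma smooth_on_pdx: "smooth_on S f \<Longrightarrow> smooth_on S (pdx f)"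
  and smooth_on_pdy: "smooth_on S f \<Longrightarrow> smooth_on S (pdy f)"
  unfolding smooth_on_def pdx_def[abs_def] pdy_def[abs_def] by (metis Ck_on.simps(2))+

lemmas smooth_on_intros =
  smooth_on_const smooth_on_add smooth_on_minus smooth_on_diff smooth_on_mult smooth_on_scaleR smooth_on_inner
  smooth_on_sin smooth_on_cos smooth_on_divide smooth_on_pdx smooth_on_pdy

lemma smooth_on_differentiable: "smooth_on S f \<Longrightarrow> p \<in> S \<Longrightarrow> f differentiable at p"
  unfolding smooth_on_def by (metis Ck_on.simps(2))

lemma smooth_on_continuous_on: "smooth_on S f \<Longrightarrow> continuous_on S f"
  unfolding smooth_on_def by (metis Ck_on.simps(1))

section \<open>Partial derivatives\<close>

lemma pd_eqI: "(f has_derivative f') (at p) \<Longrightarrow> pdx f p = f' (1, 0) \<and> pdy f p = f' (0, 1)"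
  by (simp_all add: pdx_def pdy_def frechet_derivative_at[symmetric])

lemma has_derivative_pdx_pdy:
  assumes "f differentiable at p"
  shows "(f has_derivative (\<lambda>h. fst h *\<^sub>R pdx f p + snd h *\<^sub>R pdy f p)) (at p)"
proof -
  interpret linear "frechet_derivative f (at p)"
    using assms by (rule linear_frechet_derivative)
  have "frechet_derivative f (at p) h = fst h *\<^sub>R pdx f p + snd h *\<^sub>R pdy f p" for h
    using add[of "fst h *\<^sub>R (1, 0)" "snd h *\<^sub>R (0, 1)"] unfolding pdx_def pdy_def scaleR
    by simp
  then show ?thesis
    using assms by (metis (lifting) ext frechet_derivative_works)
qed

lemma pd_cong:
  assumes "open S" "p \<in> S" "f differentiable at p" "\<And>p. p \<in> S \<Longrightarrow> f p = g p"
  shows "pdx g p = pdx f p" "pdy g p = pdy f p"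
  using frechet_derivative_transform_within_open[OF assms(3,1,2,4)]
  by (simp_all add: pdx_def pdy_def)

section \<open>Differentiation rules for the two partial derivatives\<close>

lemma pd_const: "pdx (\<lambda>p. c) p = 0" "pdy (\<lambda>p. c) p = 0"
  by (simp_all add: pdx_def pdy_def)

context
  fixes p :: "real \<times> real"
begin

lemma pd_add:
  assumes "f differentiable at p" "g differentiable at p"
  shows "pdx (\<lambda>p. f p + g p) p = pdx f p + pdx g p"
    "pdy (\<lambda>p. f p + g p) p = pdy f p + pdy g p"
  using pd_eqI[OF has_derivative_add[OF assms[THEN has_derivative_pdx_pdy]]] by simp_all

lemma pd_diff:
  assumes "f differentiable at p" "g differentiable at p"
  shows "pdx (\<lambda>p. f p - g p) p = pdx f p - pdx g p"
    "pdy (\<lambda>p. f p - g p) p = pdy f p - pdy g p"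
  using pd_eqI[OF has_derivative_diff[OF assms[THEN has_derivative_pdx_pdy]]] by simp_all

lemma pd_minus:
  assumes "f differentiable at p"
  shows "pdx (\<lambda>p. - f p) p = - pdx f p" "pdy (\<lambda>p. - f p) p = - pdy f p"
  using pd_eqI[OF has_derivative_minus[OF assms[THEN has_derivative_pdx_pdy]]] by simp_all

lemma pd_mult:
  fixes f g :: "_ \<Rightarrow> real"
  assumes "f differentiable at p" "g differentiable at p"
  shows "pdx (\<lambda>p. f p * g p) p = f p * pdx g p + pdx f p * g p"
    "pdy (\<lambda>p. f p * g p) p = f p * pdy g p + pdy f p * g p"
  using pd_eqI[OF has_derivative_mult[OF assms[THEN has_derivative_pdx_pdy]]] by simp_all

lemma pd_scaleR:
  assumes "f differentiable at p" "g differentiable at p"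
  shows "pdx (\<lambda>p. f p *\<^sub>R g p) p = f p *\<^sub>R pdx g p + pdx f p *\<^sub>R g p"
    "pdy (\<lambda>p. f p *\<^sub>R g p) p = f p *\<^sub>R pdy g p + pdy f p *\<^sub>R g p"
  using pd_eqI[OF has_derivative_scaleR[OF assms[THEN has_derivative_pdx_pdy]]] by simp_all

lemma pd_inner:
  assumes "f differentiable at p" "g differentiable at p"
  shows "pdx (\<lambda>p. f p \<bullet> g p) p = f p \<bullet> pdx g p + pdx f p \<bullet> g p"
    "pdy (\<lambda>p. f p \<bullet> g p) p = f p \<bullet> pdy g p + pdy f p \<bullet> g p"
  using pd_eqI[OF has_derivative_inner[OF assms[THEN has_derivative_pdx_pdy]]] by simp_all

lemma pd_sin:
  fixes f :: "_ \<Rightarrow> real"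
  assumes "f differentiable at p"
  shows "pdx (\<lambda>p. sin (f p)) p = cos (f p) * pdx f p"
    "pdy (\<lambda>p. sin (f p)) p = cos (f p) * pdy f p"
  using pd_eqI[OF has_derivative_sin[OF assms[THEN has_derivative_pdx_pdy]]] by simp_all

lemma pd_cos:
  fixes f :: "_ \<Rightarrow> real"
  assumes "f differentiable at p"
  shows "pdx (\<lambda>p. cos (f p)) p = - sin (f p) * pdx f p"
    "pdy (\<lambda>p. cos (f p)) p = - sin (f p) * pdy f p"
  using pd_eqI[OF has_derivative_cos[OF assms[THEN has_derivative_pdx_pdy]]] by simp_all

lemma pd_divide:
  fixes f g :: "_ \<Rightarrow> real"
  assumes "f differentiable at p" "g differentiable at p" "g p \<noteq> 0"
  shows "pdx (\<lambda>p. f p / g p) p = (pdx f p * g p - f p * pdx g p) / (g p)\<^sup>2"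
    "pdy (\<lambda>p. f p / g p) p = (pdy f p * g p - f p * pdy g p) / (g p)\<^sup>2"
  using pd_eqI[OF has_derivative_divide'[OF assms(1,2)[THEN has_derivative_pdx_pdy] assms(3)]]
  by (simp_all add: power2_eq_square)

end

text \<open>A potential obtained by integration is known only through its first derivative. Every
  directional derivative is a fixed linear combination of \<open>a\<close> and \<open>b\<close>,
  hence as smooth as they are.\<close>

lemma smooth_on_of_smooth_partials:
  assumes "open S"
    and "\<And>p. p \<in> S \<Longrightarrow> (f has_derivative (\<lambda>h. fst h *\<^sub>R a p + snd h *\<^sub>R b p)) (at p)"
    and "smooth_on S a" "smooth_on S b"
  shows "smooth_on S f"
proof -
  have "Ck_on (Suc k) S f" for k
    using assms(2)
  proof (rule Ck_on_SucI[OF \<open>open S\<close>])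
    show "Ck_on k S (\<lambda>p. fst v *\<^sub>R a p + snd v *\<^sub>R b p)" for v
      using assms(3,4) unfolding smooth_on_def
      by (intro Ck_on_add Ck_on_scaleR Ck_on_const \<open>open S\<close>) auto
  qed
  then show ?thesis
    unfolding smooth_on_def using Ck_on_Suc_D by blast
qed

lemma has_vector_derivative_pdx:
  assumes "f differentiable at (x, y)"
  shows "((\<lambda>x. f (x, y)) has_vector_derivative pdx f (x, y)) (at x within X)"
proof -
  have "((\<lambda>x. (x, y)) has_derivative (\<lambda>h. (h, 0))) (at x within X)"
    by (auto intro!: derivative_eq_intros)
  from has_derivative_compose[OF this has_derivative_pdx_pdy[OF assms]] show ?thesis
    by (simp add: has_vector_derivative_def)
qed

lemma has_vector_derivative_pdy:
  assumes "f differentiable at (x, y)"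
  shows "((\<lambda>y. f (x, y)) has_vector_derivative pdy f (x, y)) (at y within Y)"
proof -
  have "((\<lambda>y. (x, y)) has_derivative (\<lambda>h. (0, h))) (at y within Y)"
    by (auto intro!: derivative_eq_intros)
  from has_derivative_compose[OF this has_derivative_pdx_pdy[OF assms]] show ?thesis
    by (simp add: has_vector_derivative_def)
qed

text \<open>The difference of \<open>f\<close> between the two ends of a vertical segment is the
  integral of \<open>pdy f\<close>. Differentiating it in x under the integral sign gives
  \<open>pdx f\<close> as an integral of \<open>pdx (pdy f)\<close> with variable upper limit, and
  the fundamental theorem of calculus then gives its y-derivative.\<close>

lemma pdx_pdy_commute:
  fixes f :: "real \<times> real \<Rightarrow> 'b::banach"
  assumes "open S" "smooth_on S f" "p \<in> S"
  shows "pdx (pdy f) p = pdy (pdx f) p"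
proof -
  \<comment> \<open>A closed box around \<open>p\<close> inside \<open>S\<close> contains all the
    segments along which integrals are taken.\<close>
  obtain a b where pab: "p \<in> box a b" and ab: "cbox a b \<subseteq> S"
    using open_contains_cbox[of S p] assms by metis
  obtain a1 a2 b1 b2 x0 y0 where eqs: "a = (a1, a2)" "b = (b1, b2)" "p = (x0, y0)"
    by (metis surj_pair)
  have x0: "a1 < x0" "x0 < b1" and y0: "a2 < y0" "y0 < b2"
    using pab by (auto simp: eqs box_def Basis_prod_def)
  have inS: "(x, y) \<in> S" if "x \<in> {a1..b1}" "y \<in> {a2..b2}" for x y
    using ab that by (auto simp: eqs cbox_def Basis_prod_def)
  have d: "f differentiable at q" "pdx f differentiable at q" "pdy f differentiable at q" if "q \<in> S" for q
    using assms by (auto intro!: smooth_on_differentiable[OF _ that] smooth_on_pdx smooth_on_pdy)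
  have cont: "continuous_on S (pdy f)" "continuous_on S (pdx (pdy f))"
    using assms by (auto intro!: smooth_on_continuous_on smooth_on_pdx smooth_on_pdy)
  have eq: "pdx f (x0, y) = pdx f (x0, a2) + integral {a2..y} (\<lambda>t. pdx (pdy f) (x0, t))"
    if y: "y \<in> {a2..b2}" for y
  proof -
    have int: "((\<lambda>t. pdy f (x, t)) has_integral f (x, y) - f (x, a2)) {a2..y}" if "x \<in> {a1..b1}" for x
      using that y by (intro fundamental_theorem_of_calculus has_vector_derivative_pdy d inS) auto
    have "((\<lambda>x. integral (cbox a2 y) (\<lambda>t. pdy f (x, t))) has_vector_derivative
        integral (cbox a2 y) (\<lambda>t. pdx (pdy f) (x0, t))) (at x0 within {a1..b1})"
    proof (rule leibniz_rule_vector_derivative)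
      show "((\<lambda>x. pdy f (x, t)) has_vector_derivative pdx (pdy f) (x, t)) (at x within {a1..b1})"
        if "x \<in> {a1..b1}" "t \<in> cbox a2 y" for x t
        using that y by (intro has_vector_derivative_pdx d inS) auto
      show "(\<lambda>t. pdy f (x, t)) integrable_on cbox a2 y" if "x \<in> {a1..b1}" for x
        using int[OF that] by auto
      show "continuous_on ({a1..b1} \<times> cbox a2 y) (\<lambda>(x, t). pdx (pdy f) (x, t))"
        using y inS by (auto intro!: continuous_on_subset[OF cont(2)])
    qed (use x0 in auto)
    then have "((\<lambda>x. f (x, y) - f (x, a2)) has_vector_derivative
        integral {a2..y} (\<lambda>t. pdx (pdy f) (x0, t))) (at x0 within {a1..b1})"
      unfolding box_real
    proof (rule has_vector_derivative_transform[rotated 2])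
      show "f (x, y) - f (x, a2) = integral {a2..y} (\<lambda>t. pdy f (x, t))" if "x \<in> {a1..b1}" for x
        using integral_unique[OF int[OF that]] by (rule sym)
    qed (use x0 in simp)
    moreover have "((\<lambda>x. f (x, y) - f (x, a2)) has_vector_derivative
        pdx f (x0, y) - pdx f (x0, a2)) (at x0 within {a1..b1})"
      using x0 y by (intro has_vector_derivative_diff has_vector_derivative_pdx d inS) auto
    \<comment> \<open>Since \<open>x0\<close> is interior to the interval, the two one-variable
      derivatives just found are ordinary ones and must coincide by uniqueness.\<close>
    moreover have "at x0 within {a1..b1} = at x0"
      using x0 by (intro at_within_interior) simp
    ultimately have "integral {a2..y} (\<lambda>t. pdx (pdy f) (x0, t)) = pdx f (x0, y) - pdx f (x0, a2)"
      by (simp only:) (rule vector_derivative_unique_at)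
    then show ?thesis by simp
  qed
  have "continuous_on {a2..b2} (\<lambda>t. pdx (pdy f) (x0, t))"
    using x0 inS by (intro continuous_on_compose2[OF cont(2)] continuous_intros) auto
  from integral_has_vector_derivative[OF this, of y0]
  have "((\<lambda>y. pdx f (x0, a2) + integral {a2..y} (\<lambda>t. pdx (pdy f) (x0, t))) has_vector_derivative
      pdx (pdy f) (x0, y0)) (at y0 within {a2..b2})"
    using has_vector_derivative_add[OF has_vector_derivative_const] y0 by fastforce
  then have "((\<lambda>y. pdx f (x0, y)) has_vector_derivative pdx (pdy f) (x0, y0)) (at y0 within {a2..b2})"
    by (rule has_vector_derivative_transform[rotated 2]) (use y0 in simp, use eq in blast)
  moreover have "((\<lambda>y. pdx f (x0, y)) has_vector_derivative pdy (pdx f) (x0, y0)) (at y0 within {a2..b2})"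
    using assms(3) by (intro has_vector_derivative_pdy d) (simp add: eqs)
  moreover have "at y0 within {a2..b2} = at y0"
    using y0 by (intro at_within_interior) simp
  ultimately show ?thesis
    unfolding eqs(3) by (simp only:) (rule vector_derivative_unique_at)
qed

section \<open>Closed one-forms on simply connected planar domains\<close>

text \<open>Closedness of the form with coefficients \<open>A\<close> and \<open>B\<close> is
  encoded by the shared function \<open>A2\<close>, which is both the second partial derivative of
  \<open>A\<close> and the first of \<open>B\<close>. The primitive is the integral of the form
  along the segment from 0.\<close>

lemma closed_form_exact_convex:
  fixes A B :: "complex \<Rightarrow> 'b::banach"
  assumes D: "open D" "convex D" "0 \<in> D"
    and A: "\<And>z. z \<in> D \<Longrightarrow> (A has_derivative (\<lambda>h. Re h *\<^sub>R A1 z + Im h *\<^sub>R A2 z)) (at z)"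
    and B: "\<And>z. z \<in> D \<Longrightarrow> (B has_derivative (\<lambda>h. Re h *\<^sub>R A2 z + Im h *\<^sub>R B2 z)) (at z)"
    and cont: "continuous_on D A1" "continuous_on D A2" "continuous_on D B2"
  obtains F where
    "\<And>z. z \<in> D \<Longrightarrow> (F has_derivative (\<lambda>h. Re h *\<^sub>R A z + Im h *\<^sub>R B z)) (at z)"
proof
  \<comment> \<open>\<open>P\<close> and \<open>Q\<close> are the partial derivatives of the
    integrand \<open>f\<close> in the real and imaginary part of \<open>z\<close>. By closedness
    they are also the t-derivatives of \<open>t *\<^sub>R A (t *\<^sub>R z)\<close> and
    \<open>t *\<^sub>R B (t *\<^sub>R z)\<close>, so their integrals over the unit interval can be
    evaluated.\<close>
  define P where "P = (\<lambda>z t. A (t *\<^sub>R z) + t *\<^sub>R (Re z *\<^sub>R A1 (t *\<^sub>R z) + Im z *\<^sub>R A2 (t *\<^sub>R z)))"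
  define Q where "Q = (\<lambda>z t. B (t *\<^sub>R z) + t *\<^sub>R (Re z *\<^sub>R A2 (t *\<^sub>R z) + Im z *\<^sub>R B2 (t *\<^sub>R z)))"
  define f where "f = (\<lambda>z t. Re z *\<^sub>R A (t *\<^sub>R z) + Im z *\<^sub>R B (t *\<^sub>R z))"
  \<comment> \<open>The derivative of the integrand as a bounded linear map, the form in which
    differentiation under the integral sign takes it.\<close>
  define f' where "f' = (\<lambda>z t. blinfun_compose (blinfun_scaleR_left (P z t)) (Blinfun Re) +
    blinfun_compose (blinfun_scaleR_left (Q z t)) (Blinfun Im))"
  have f'_apply: "blinfun_apply (f' z t) h = Re h *\<^sub>R P z t + Im h *\<^sub>R Q z t" for z t h
    by (simp add: f'_def plus_blinfun.rep_eq bounded_linear_Blinfun_apply bounded_linear_Re bounded_linear_Im)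
  have scale: "t *\<^sub>R z \<in> D" if "z \<in> D" "t \<in> {0..1}" for z t
  proof -
    have "(1 - t) *\<^sub>R 0 + t *\<^sub>R z \<in> D"
      using that D by (intro convexD_alt) auto
    then show ?thesis by simp
  qed
  have contAB: "continuous_on D A" "continuous_on D B"
    using A B by (meson has_derivative_continuous continuous_at_imp_continuous_on)+
  have cont2: "continuous_on (D \<times> cbox 0 1) (\<lambda>x. h (snd x *\<^sub>R fst x))" if "continuous_on D h"
    for h :: "complex \<Rightarrow> 'b"
    using scale by (intro continuous_on_compose2[OF that] continuous_intros) auto
  have contP: "continuous_on (D \<times> cbox 0 1) (\<lambda>x. P (fst x) (snd x))"
    unfolding P_def by (intro continuous_intros cont2 contAB cont)
  have contQ: "continuous_on (D \<times> cbox 0 1) (\<lambda>x. Q (fst x) (snd x))"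
    unfolding Q_def by (intro continuous_intros cont2 contAB cont)
  \<comment> \<open>\<open>f'\<close> depends on \<open>P\<close> and \<open>Q\<close> through
    bounded linear maps, so it inherits their joint continuity.\<close>
  have lin: "bounded_linear (\<lambda>p :: 'b. blinfun_compose (blinfun_scaleR_left p) C)" for C :: "complex \<Rightarrow>\<^sub>L real"
    by (rule bounded_linear_compose[OF bounded_bilinear.bounded_linear_left[OF bounded_bilinear_blinfun_compose]
          bounded_linear_blinfun_scaleR_left])
  have contf': "continuous_on (D \<times> cbox 0 1) (\<lambda>x. f' (fst x) (snd x))"
    unfolding f'_def
    by (rule continuous_on_add[OF bounded_linear.continuous_on[OF lin contP] bounded_linear.continuous_on[OF lin contQ]])
  fix z0 assume z0: "z0 \<in> D"
  have "((\<lambda>z. integral (cbox 0 1) (f z)) has_derivative integral (cbox 0 1) (f' z0)) (at z0 within D)"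
  proof (rule leibniz_rule[OF _ _ _ z0 \<open>convex D\<close>])
    fix z t assume zt: "z \<in> D" "t \<in> cbox (0::real) 1"
    have s: "((\<lambda>z. t *\<^sub>R z) has_derivative (\<lambda>h. t *\<^sub>R h)) (at z within D)"
      by (auto intro!: derivative_eq_intros)
    have tz: "t *\<^sub>R z \<in> D"
      using zt by (intro scale) auto
    have "((\<lambda>z. f z t) has_derivative (\<lambda>h. (Re z *\<^sub>R (Re (t *\<^sub>R h) *\<^sub>R A1 (t *\<^sub>R z) + Im (t *\<^sub>R h) *\<^sub>R A2 (t *\<^sub>R z))
        + Re h *\<^sub>R A (t *\<^sub>R z)) + (Im z *\<^sub>R (Re (t *\<^sub>R h) *\<^sub>R A2 (t *\<^sub>R z) + Im (t *\<^sub>R h) *\<^sub>R B2 (t *\<^sub>R z))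
        + Im h *\<^sub>R B (t *\<^sub>R z)))) (at z within D)"
      unfolding f_def
      by (intro has_derivative_add has_derivative_scaleR has_derivative_Re has_derivative_Im
          has_derivative_ident has_derivative_compose[OF s] A B tz)
    then show "((\<lambda>z. f z t) has_derivative blinfun_apply (f' z t)) (at z within D)"
      by (rule has_derivative_eq_rhs) (auto simp: f'_apply P_def Q_def algebra_simps)
  next
    fix z assume z: "z \<in> D"
    show "f z integrable_on cbox 0 1"
      unfolding f_def using scale[OF z]
      by (intro integrable_continuous continuous_intros continuous_on_compose2[OF contAB(1)]
          continuous_on_compose2[OF contAB(2)]) auto
  next
    show "continuous_on (D \<times> cbox 0 1) (\<lambda>(z, t). f' z t)"
      using contf' by (simp add: split_beta)
  qed
  moreover have "blinfun_apply (integral (cbox 0 1) (f' z0)) = (\<lambda>h. Re h *\<^sub>R A z0 + Im h *\<^sub>R B z0)"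
  proof
    fix h
    have comp: "((\<lambda>t. t *\<^sub>R a (t *\<^sub>R z0)) has_vector_derivative
        a (t *\<^sub>R z0) + t *\<^sub>R (Re z0 *\<^sub>R a1 (t *\<^sub>R z0) + Im z0 *\<^sub>R a2 (t *\<^sub>R z0))) (at t within {0..1})"
      if "t \<in> {0..1}" "\<And>z. z \<in> D \<Longrightarrow> (a has_derivative (\<lambda>h. Re h *\<^sub>R a1 z + Im h *\<^sub>R a2 z)) (at z)"
      for t and a a1 a2 :: "complex \<Rightarrow> 'b"
    proof -
      have s: "((\<lambda>t. t *\<^sub>R z0) has_derivative (\<lambda>h. h *\<^sub>R z0)) (at t within {0..1})"
        by (auto intro!: derivative_eq_intros)
      have "((\<lambda>t. t *\<^sub>R a (t *\<^sub>R z0)) has_derivative (\<lambda>h. t *\<^sub>R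
          (Re (h *\<^sub>R z0) *\<^sub>R a1 (t *\<^sub>R z0) + Im (h *\<^sub>R z0) *\<^sub>R a2 (t *\<^sub>R z0)) + h *\<^sub>R a (t *\<^sub>R z0)))
          (at t within {0..1})"
        using that(1) by (intro has_derivative_scaleR has_derivative_ident
            has_derivative_compose[OF s] that(2) scale z0)
      then show ?thesis
        unfolding has_vector_derivative_def
        by (rule has_derivative_eq_rhs) (auto simp: algebra_simps)
    qed
    have "((\<lambda>t. P z0 t) has_integral 1 *\<^sub>R A (1 *\<^sub>R z0) - 0 *\<^sub>R A (0 *\<^sub>R z0)) {0..1}"
      unfolding P_def by (intro fundamental_theorem_of_calculus comp A) auto
    moreover have "((\<lambda>t. Q z0 t) has_integral 1 *\<^sub>R B (1 *\<^sub>R z0) - 0 *\<^sub>R B (0 *\<^sub>R z0)) {0..1}"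
      unfolding Q_def by (intro fundamental_theorem_of_calculus comp B) auto
    ultimately have "((\<lambda>t. Re h *\<^sub>R P z0 t + Im h *\<^sub>R Q z0 t) has_integral Re h *\<^sub>R A z0 + Im h *\<^sub>R B z0) {0..1}"
      by (intro has_integral_add has_integral_cmul) auto
    moreover have "f' z0 integrable_on {0..1}"
      by (intro integrable_continuous_interval continuous_on_compose2[OF contf', of _ "\<lambda>t. (z0, t)", simplified]
          continuous_intros) (use z0 in auto)
    then have "((\<lambda>t. blinfun_apply (f' z0 t) h) has_integral blinfun_apply (integral {0..1} (f' z0)) h) {0..1}"
      using has_integral_linear[OF integrable_integral blinfun.bounded_linear_left, of "f' z0" "{0..1}" h]
      by (simp add: o_def)
    ultimately show "blinfun_apply (integral (cbox 0 1) (f' z0)) h = Re h *\<^sub>R A z0 + Im h *\<^sub>R B z0"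
      by (simp add: f'_apply has_integral_unique)
  qed
  ultimately show "((\<lambda>z. integral (cbox 0 1) (f z)) has_derivative (\<lambda>h. Re h *\<^sub>R A z0 + Im h *\<^sub>R B z0)) (at z0)"
    using at_within_open[OF z0 \<open>open D\<close>] by simp
qed

text \<open>A proper simply connected open subset is mapped to the unit disc by the Riemann mapping
  theorem. The whole plane is already convex, and the identity serves.\<close>

lemma simply_connected_biholomorphic_convex:
  assumes "open S" "simply_connected S" "S \<noteq> {}"
  obtains D f g where "open D" "convex D" "(0::complex) \<in> D" "f holomorphic_on S" "g holomorphic_on D"
    "\<And>z. z \<in> S \<Longrightarrow> f z \<in> D \<and> g (f z) = z" "\<And>w. w \<in> D \<Longrightarrow> g w \<in> S"
proof (cases "S = UNIV")
  case True
  show ?thesis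
    by (rule that[of UNIV "\<lambda>z. z" "\<lambda>z. z"]) (use True in auto)
next
  case False
  then obtain f g where fg: "f holomorphic_on S" "g holomorphic_on ball 0 1"
    "\<forall>z\<in>S. f z \<in> ball 0 1 \<and> g (f z) = z" "\<forall>w\<in>ball 0 1. g w \<in> S \<and> f (g w) = w"
    using Riemann_mapping_theorem[of S] assms by blast
  show ?thesis
    by (rule that[of "ball 0 1" f g]) (use fg in auto)
qed

text \<open>The form is pulled back to a convex domain along a Riemann map \<open>g\<close>, and the primitive
  found there is carried back along the inverse \<open>f\<close>.\<close>

lemma closed_form_exact:
  fixes A B :: "real \<times> real \<Rightarrow> 'b::banach"
  assumes U: "open U" "simply_connected U"
    and A: "smooth_on U A" and B: "smooth_on U B"
    and closed: "\<And>p. p \<in> U \<Longrightarrow> pdy A p = pdx B p"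
  obtains F where
    "\<And>p. p \<in> U \<Longrightarrow> (F has_derivative (\<lambda>h. fst h *\<^sub>R A p + snd h *\<^sub>R B p)) (at p)"
proof (cases "U = {}")
  case True
  then show ?thesis by (auto intro: that)
next
  case False
  \<comment> \<open>\<open>c\<close> and \<open>e\<close> identify the real plane with the complex
    plane in both directions, so that a Riemann map can be used.\<close>
  define c where "c = (\<lambda>p::real \<times> real. Complex (fst p) (snd p))"
  define e where "e = (\<lambda>z. (Re z, Im z))"
  have c_deriv: "(c has_derivative c) (at p)" for p
  proof -
    have "linear c"
      by (rule linearI) (auto simp: c_def complex_eq_iff)
    then show ?thesis
      by (simp add: linear_linear linear_imp_has_derivative)
  qed
  have e_cont: "continuous_on X e" for X
    unfolding e_def by (intro continuous_intros)
  have c_cont: "continuous_on X c" for X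
    using c_deriv by (intro continuous_at_imp_continuous_on) (auto intro: has_derivative_continuous)
  define S where "S = e -` U"
  have ec: "e (c p) = p" "c (e z) = z" for p z
    by (simp_all add: c_def e_def)
  have cU: "c ` U = S"
    unfolding S_def using ec by (auto simp: image_iff) metis
  then have "e ` S = U"
    by (auto simp: image_image ec)
  then have "U homeomorphic S"
    by (intro homeomorphicI[of c U S e] cU c_cont e_cont) (simp_all add: ec)
  then have "simply_connected S"
    using U(2) homeomorphic_simply_connected by blast
  moreover have "open S"
    unfolding S_def using U(1) e_cont by (simp add: open_vimage)
  moreover have "S \<noteq> {}"
    using False cU by blast
  ultimately obtain D f g where D: "open D" "convex D" "0 \<in> D" and f: "f holomorphic_on S"
    and g: "g holomorphic_on D" and fg: "\<And>z. z \<in> S \<Longrightarrow> f z \<in> D \<and> g (f z) = z"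
    and gD: "\<And>w. w \<in> D \<Longrightarrow> g w \<in> S"
    using simply_connected_biholomorphic_convex by blast
  define g' where "g' = deriv g"
  define g'' where "g'' = deriv g'"
  have g': "g' holomorphic_on D" and g'': "g'' holomorphic_on D"
    unfolding g''_def g'_def using g D(1) by (auto intro: holomorphic_deriv)
  have dg: "(g has_derivative (\<lambda>h. g' w * h)) (at w)"
    and dg': "(g' has_derivative (\<lambda>h. g'' w * h)) (at w)" if "w \<in> D" for w
    using that D(1) g g' holomorphic_derivI unfolding g'_def g''_def has_field_derivative_def by blast+
  have eg: "e (g w) \<in> U" if "w \<in> D" for w
    using gD[OF that] by (simp add: S_def)
  have deg: "((\<lambda>w. e (g w)) has_derivative (\<lambda>h. (Re (g' w * h), Im (g' w * h)))) (at w)" if "w \<in> D" for w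
    unfolding e_def by (intro has_derivative_Pair has_derivative_Re has_derivative_Im dg that)
  have dcomp: "((\<lambda>w. a (e (g w))) has_derivative (\<lambda>h. Re (g' w * h) *\<^sub>R pdx a (e (g w)) +
      Im (g' w * h) *\<^sub>R pdy a (e (g w)))) (at w)" if "w \<in> D" "smooth_on U a" for w and a :: "_ \<Rightarrow> 'b"
    using has_derivative_compose[OF deg[OF that(1)]
        has_derivative_pdx_pdy[OF smooth_on_differentiable[OF that(2) eg[OF that(1)]]]]
    by simp
  have contcomp: "continuous_on D (\<lambda>w. a (e (g w)))" if "smooth_on U a" for a :: "_ \<Rightarrow> 'b"
    using eg by (intro continuous_on_compose2[OF smooth_on_continuous_on[OF that]]
        continuous_on_compose2[OF e_cont] holomorphic_on_imp_continuous_on[OF g]) auto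
  define a b where "a = (\<lambda>w. A (e (g w)))" and "b = (\<lambda>w. B (e (g w)))"
  \<comment> \<open>By closedness \<open>a2\<close> also stands for the y-derivative of
    \<open>A\<close>.\<close>
  define a1 a2 b2 where "a1 = (\<lambda>w. pdx A (e (g w)))" and "a2 = (\<lambda>w. pdx B (e (g w)))"
    and "b2 = (\<lambda>w. pdy B (e (g w)))"
  have da: "(a has_derivative (\<lambda>h. Re (g' w * h) *\<^sub>R a1 w + Im (g' w * h) *\<^sub>R a2 w)) (at w)"
    and db: "(b has_derivative (\<lambda>h. Re (g' w * h) *\<^sub>R a2 w + Im (g' w * h) *\<^sub>R b2 w)) (at w)"
    if "w \<in> D" for w
    using dcomp[OF that A] dcomp[OF that B] closed[OF eg[OF that]]
    by (simp_all add: a_def b_def a1_def a2_def b2_def)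
  have cont: "continuous_on D a" "continuous_on D b" "continuous_on D a1" "continuous_on D a2"
      "continuous_on D b2" "continuous_on D g'" "continuous_on D g''"
    unfolding a_def b_def a1_def a2_def b2_def
    by (intro contcomp A B smooth_on_pdx smooth_on_pdy holomorphic_on_imp_continuous_on g' g'')+
  \<comment> \<open>The coefficients are those of the pullback under \<open>g\<close>: with
    \<open>g'\<close> = u + iv, dx becomes u dX - v dY and dy becomes v dX + u dY. The pulled-back
    form is closed because the derivative of \<open>g'\<close> is multiplication by the complex
    number \<open>g'' w\<close>, which makes the two mixed coefficients below equal.\<close>
  obtain F where F: "\<And>w. w \<in> D \<Longrightarrow> (F has_derivative (\<lambda>h.
      Re h *\<^sub>R (Re (g' w) *\<^sub>R a w + Im (g' w) *\<^sub>R b w) +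
      Im h *\<^sub>R (Re (g' w) *\<^sub>R b w - Im (g' w) *\<^sub>R a w))) (at w)"
  proof (rule closed_form_exact_convex[OF D])
    fix w assume w: "w \<in> D"
    have "((\<lambda>w. Re (g' w) *\<^sub>R a w + Im (g' w) *\<^sub>R b w) has_derivative (\<lambda>h.
       (Re (g' w) *\<^sub>R (Re (g' w * h) *\<^sub>R a1 w + Im (g' w * h) *\<^sub>R a2 w) + Re (g'' w * h) *\<^sub>R a w) +
       (Im (g' w) *\<^sub>R (Re (g' w * h) *\<^sub>R a2 w + Im (g' w * h) *\<^sub>R b2 w) + Im (g'' w * h) *\<^sub>R b w))) (at w)"
      by (intro has_derivative_add has_derivative_scaleR has_derivative_Re has_derivative_Im da db dg' w)
    then show "((\<lambda>w. Re (g' w) *\<^sub>R a w + Im (g' w) *\<^sub>R b w) has_derivative (\<lambda>h.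
       Re h *\<^sub>R (Re (g' w)^2 *\<^sub>R a1 w + (2 * Re (g' w) * Im (g' w)) *\<^sub>R a2 w + Im (g' w)^2 *\<^sub>R b2 w
         + Re (g'' w) *\<^sub>R a w + Im (g'' w) *\<^sub>R b w) +
       Im h *\<^sub>R ((Re (g' w) * Im (g' w)) *\<^sub>R (b2 w - a1 w) + (Re (g' w)^2 - Im (g' w)^2) *\<^sub>R a2 w
         + Re (g'' w) *\<^sub>R b w - Im (g'' w) *\<^sub>R a w))) (at w)"
      by (rule has_derivative_eq_rhs) (auto simp: algebra_simps power2_eq_square simp flip: scaleR_2)
    have "((\<lambda>w. Re (g' w) *\<^sub>R b w - Im (g' w) *\<^sub>R a w) has_derivative (\<lambda>h.
       (Re (g' w) *\<^sub>R (Re (g' w * h) *\<^sub>R a2 w + Im (g' w * h) *\<^sub>R b2 w) + Re (g'' w * h) *\<^sub>R b w) -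
       (Im (g' w) *\<^sub>R (Re (g' w * h) *\<^sub>R a1 w + Im (g' w * h) *\<^sub>R a2 w) + Im (g'' w * h) *\<^sub>R a w))) (at w)"
      by (intro has_derivative_diff has_derivative_scaleR has_derivative_Re has_derivative_Im da db dg' w)
    then show "((\<lambda>w. Re (g' w) *\<^sub>R b w - Im (g' w) *\<^sub>R a w) has_derivative (\<lambda>h.
       Re h *\<^sub>R ((Re (g' w) * Im (g' w)) *\<^sub>R (b2 w - a1 w) + (Re (g' w)^2 - Im (g' w)^2) *\<^sub>R a2 w
         + Re (g'' w) *\<^sub>R b w - Im (g'' w) *\<^sub>R a w) +
       Im h *\<^sub>R (Im (g' w)^2 *\<^sub>R a1 w - (2 * Re (g' w) * Im (g' w)) *\<^sub>R a2 w + Re (g' w)^2 *\<^sub>R b2 w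
         - Im (g'' w) *\<^sub>R b w - Re (g'' w) *\<^sub>R a w))) (at w)"
      by (rule has_derivative_eq_rhs) (auto simp: algebra_simps power2_eq_square simp flip: scaleR_2)
  qed ((intro continuous_intros cont)+, blast)
  show ?thesis
  proof (rule that)
    fix p assume p: "p \<in> U"
    then have pS: "c p \<in> S"
      by (simp add: S_def c_def e_def)
    note fgp = fg[OF pS]
    define f' where "f' = deriv f (c p)"
    have df: "(f has_field_derivative f') (at (c p))"
      unfolding f'_def using f \<open>open S\<close> pS by (rule holomorphic_derivI)
    have "(g has_field_derivative g' (f (c p))) (at (f (c p)))"
      using g D(1) fgp unfolding g'_def by (blast intro: holomorphic_derivI)
    from DERIV_chain[OF this df] have "((\<lambda>z. g (f z)) has_field_derivative g' (f (c p)) * f') (at (c p))"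
      by (simp add: o_def)
    then have "((\<lambda>z. z) has_field_derivative g' (f (c p)) * f') (at (c p))"
      by (rule has_field_derivative_transform_within_open[OF _ \<open>open S\<close> pS]) (use fg in auto)
    then have inv: "g' (f (c p)) * f' = 1"
      using DERIV_ident DERIV_unique by blast
    \<comment> \<open>The chain rule for \<open>g\<close> after \<open>f\<close> has made the two
      derivatives reciprocal, so the factor introduced by the pullback cancels and the original
      coefficients return.\<close>
    have "c h = g' (f (c p)) * (f' * c h)" for h
      using inv by (simp flip: mult.assoc)
    then have h: "fst h = Re (g' (f (c p)) * (f' * c h))" "snd h = Im (g' (f (c p)) * (f' * c h))" for h
      by (metis c_def complex.sel)+
    have ab: "a (f (c p)) = A p" "b (f (c p)) = B p"
      using fgp by (simp_all add: a_def b_def e_def c_def)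
    have "((\<lambda>p. f (c p)) has_derivative (\<lambda>h. f' * c h)) (at p)"
      using has_derivative_compose[OF c_deriv df[unfolded has_field_derivative_def]] .
    from has_derivative_compose[OF this F[of "f (c p)"]] fgp
    show "((\<lambda>p. F (f (c p))) has_derivative (\<lambda>h. fst h *\<^sub>R A p + snd h *\<^sub>R B p)) (at p)"
      unfolding h ab by (auto elim!: has_derivative_eq_rhs simp: algebra_simps)
  qed
qed

section \<open>The moving frame of a pseudospherical surface\<close>

lemma pd_smooth_cong:
  assumes "open U" "smooth_on U f" "p \<in> U" "\<And>p. p \<in> U \<Longrightarrow> f p = g p"
  shows "pdx g p = pdx f p" "pdy g p = pdy f p"
  using pd_cong[OF assms(1,3) smooth_on_differentiable[OF assms(2,3)] assms(4)] by auto

text \<open>Replacing \<open>b\<close> by its component \<open>w\<close> orthogonal to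
  \<open>a\<close>, of squared length \<open>(sin t)\<^sup>2\<close>, makes the frame orthogonal. A
  nonzero \<open>v\<close> would then give four pairwise orthogonal nonzero vectors in
  three-dimensional space.\<close>

lemma orthogonal_to_frame_eq_0:
  fixes v n a b :: "real^3"
  assumes "n \<bullet> n = 1" "n \<bullet> a = 0" "n \<bullet> b = 0" "a \<bullet> a = 1" "b \<bullet> b = 1" "a \<bullet> b = cos t" "sin t \<noteq> 0"
    and v: "v \<bullet> n = 0" "v \<bullet> a = 0" "v \<bullet> b = 0"
  shows "v = 0"
proof (rule ccontr)
  assume "v \<noteq> 0"
  define w where "w = b - cos t *\<^sub>R a"
  have w: "w \<bullet> n = 0" "w \<bullet> a = 0" "w \<bullet> v = 0"
    using assms by (simp_all add: w_def inner_diff_left inner_diff_right inner_commute)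
  have "w \<bullet> w = 1 - cos t * cos t"
    using assms by (simp add: w_def inner_diff_left inner_diff_right inner_commute)
  also have "\<dots> = (sin t)\<^sup>2"
    by (simp add: sin_squared_eq flip: power2_eq_square)
  finally have "w \<noteq> 0" using assms(7) by auto
  have ne: "n \<noteq> 0" "a \<noteq> 0" using assms by auto
  have "pairwise orthogonal {v, n, a, w}"
    using w v assms(2) by (auto simp: pairwise_insert orthogonal_def inner_commute)
  then have "independent {v, n, a, w}"
    using \<open>w \<noteq> 0\<close> \<open>v \<noteq> 0\<close> ne by (intro pairwise_orthogonal_independent) auto
  then have "card {v, n, a, w} \<le> 3"
    using independent_bound by fastforce
  moreover have "card {v, n, a, w} = 4"
  proof -
    have "v \<noteq> n" "v \<noteq> a" "v \<noteq> w" "n \<noteq> a" "n \<noteq> w" "a \<noteq> w"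
      using w v assms(2) \<open>w \<noteq> 0\<close> \<open>v \<noteq> 0\<close> ne by (metis inner_eq_zero_iff inner_commute)+
    then show ?thesis by simp
  qed
  ultimately show False by simp
qed

locale pseudospherical =
  fixes U :: "(real \<times> real) set" and \<phi> :: "real \<times> real \<Rightarrow> real"
    and r n :: "real \<times> real \<Rightarrow> real^3"
  assumes open_U: "open U" and dini: "dini_surface U \<phi> r n"
begin

lemma smooth: "smooth_on U \<phi>" "smooth_on U r" "smooth_on U n"
  using dini by (auto simp: dini_surface_def)

lemmas smooth_intros = smooth open_U smooth_on_intros

lemmas differentiable = smooth_on_differentiable[of U]

lemma sin_nonzero: "p \<in> U \<Longrightarrow> sin (\<phi> p) \<noteq> 0"
  using dini by (auto simp: dini_surface_def)

lemma fundamental_forms: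
  assumes "p \<in> U"
  shows "n p \<bullet> n p = 1" "n p \<bullet> pdx r p = 0" "n p \<bullet> pdy r p = 0"
    "pdx r p \<bullet> pdx r p = 1" "pdx r p \<bullet> pdy r p = cos (\<phi> p)" "pdy r p \<bullet> pdy r p = 1"
    "n p \<bullet> pdx (pdx r) p = 0" "n p \<bullet> pdy (pdx r) p = sin (\<phi> p)" "n p \<bullet> pdy (pdy r) p = 0"
  using dini assms by (auto simp: dini_surface_def)

text \<open>Reduces every vector identity for the surface to three scalar ones.\<close>

lemma frame_eqI:
  assumes p: "p \<in> U" and "v \<bullet> n p = w \<bullet> n p" "v \<bullet> pdx r p = w \<bullet> pdx r p" "v \<bullet> pdy r p = w \<bullet> pdy r p"
  shows "v = w"
  using orthogonal_to_frame_eq_0[OF fundamental_forms(1-4)[OF p] fundamental_forms(6,5)[OF p]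
      sin_nonzero[OF p], of "v - w"] assms
  by (simp add: inner_diff_left)

text \<open>Differentiating a known inner product is the source of all frame coefficients.\<close>

lemma pd_inner_eq:
  assumes "p \<in> U" "smooth_on U f" "smooth_on U g" "smooth_on U h"
    and "\<And>p. p \<in> U \<Longrightarrow> f p \<bullet> g p = h p"
  shows "f p \<bullet> pdx g p + pdx f p \<bullet> g p = pdx h p" "f p \<bullet> pdy g p + pdy f p \<bullet> g p = pdy h p"
proof -
  have fg: "smooth_on U (\<lambda>p. f p \<bullet> g p)"
    using assms by (intro smooth_intros)
  have "f differentiable at p" "g differentiable at p"
    using assms by (auto intro: differentiable)
  then show "f p \<bullet> pdx g p + pdx f p \<bullet> g p = pdx h p" "f p \<bullet> pdy g p + pdy f p \<bullet> g p = pdy h p"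
    using pd_smooth_cong[OF open_U fg assms(1,5)] by (simp_all add: pd_inner)
qed

lemma mixed_partials:
  fixes f :: "real \<times> real \<Rightarrow> 'b::banach"
  assumes "p \<in> U" "smooth_on U f"
  shows "pdx (pdy f) p = pdy (pdx f) p"
  using pdx_pdy_commute[OF open_U assms(2,1)] .

lemma smooth_derivatives: "smooth_on U (pdx r)" "smooth_on U (pdy r)" "smooth_on U (pdx n)" "smooth_on U (pdy n)"
  "smooth_on U (pdx \<phi>)" "smooth_on U (pdy \<phi>)" "smooth_on U (pdx (pdx r))"
  "smooth_on U (\<lambda>p. cos (\<phi> p))" "smooth_on U (\<lambda>p. sin (\<phi> p))"
  by (intro smooth_intros)+

lemma pd_cos_phi: "p \<in> U \<Longrightarrow> pdx (\<lambda>p. cos (\<phi> p)) p = - sin (\<phi> p) * pdx \<phi> p"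
    "p \<in> U \<Longrightarrow> pdy (\<lambda>p. cos (\<phi> p)) p = - sin (\<phi> p) * pdy \<phi> p"
  and pd_sin_phi: "p \<in> U \<Longrightarrow> pdx (\<lambda>p. sin (\<phi> p)) p = cos (\<phi> p) * pdx \<phi> p"
    "p \<in> U \<Longrightarrow> pdy (\<lambda>p. sin (\<phi> p)) p = cos (\<phi> p) * pdy \<phi> p"
  by (simp_all add: pd_cos pd_sin differentiable smooth)

text \<open>Each of the six inner products among \<open>n\<close>, \<open>pdx r\<close> and
  \<open>pdy r\<close> is differentiated in both directions. The relations with \<open>n\<close>
  turn the second fundamental form into the tangential parts of the derivatives of \<open>n\<close>;
  the other three give those of the second derivatives of \<open>r\<close>, with the mixed partials
  of \<open>r\<close> identified.\<close>

lemma frame_derivatives_inner: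
  assumes p: "p \<in> U"
  shows "pdx n p \<bullet> n p = 0" "pdy n p \<bullet> n p = 0"
    "pdx n p \<bullet> pdx r p = 0" "pdx n p \<bullet> pdy r p = - sin (\<phi> p)"
    "pdy n p \<bullet> pdx r p = - sin (\<phi> p)" "pdy n p \<bullet> pdy r p = 0"
    "pdx (pdx r) p \<bullet> pdx r p = 0" "pdy (pdx r) p \<bullet> pdx r p = 0"
    "pdy (pdx r) p \<bullet> pdy r p = 0" "pdy (pdy r) p \<bullet> pdy r p = 0"
    "pdx (pdx r) p \<bullet> pdy r p = - sin (\<phi> p) * pdx \<phi> p"
    "pdy (pdy r) p \<bullet> pdx r p = - sin (\<phi> p) * pdy \<phi> p"
  using pd_inner_eq[OF p smooth(3) smooth(3) smooth_on_const fundamental_forms(1)]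
    pd_inner_eq[OF p smooth(3) smooth_derivatives(1) smooth_on_const fundamental_forms(2)]
    pd_inner_eq[OF p smooth(3) smooth_derivatives(2) smooth_on_const fundamental_forms(3)]
    pd_inner_eq[OF p smooth_derivatives(1) smooth_derivatives(1) smooth_on_const fundamental_forms(4)]
    pd_inner_eq[OF p smooth_derivatives(2) smooth_derivatives(2) smooth_on_const fundamental_forms(6)]
    pd_inner_eq[OF p smooth_derivatives(1) smooth_derivatives(2) smooth_derivatives(8) fundamental_forms(5)]
    fundamental_forms[OF p]
  by (simp_all add: pd_const mixed_partials[OF p] smooth pd_cos_phi p inner_commute)

section \<open>The Gauss-Weingarten equations and their integrability condition\<close>

lemma weingarten:
  assumes p: "p \<in> U"
  shows "pdx n p = (cos (\<phi> p) / sin (\<phi> p)) *\<^sub>R pdx r p - (1 / sin (\<phi> p)) *\<^sub>R pdy r p"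
    "pdy n p = (cos (\<phi> p) / sin (\<phi> p)) *\<^sub>R pdy r p - (1 / sin (\<phi> p)) *\<^sub>R pdx r p"
proof -
  show "pdx n p = (cos (\<phi> p) / sin (\<phi> p)) *\<^sub>R pdx r p - (1 / sin (\<phi> p)) *\<^sub>R pdy r p"
    by (rule frame_eqI[OF p]) (use fundamental_forms[OF p] frame_derivatives_inner[OF p] sin_nonzero[OF p]
        sin_cos_squared_add3[of "\<phi> p"] in \<open>simp_all add: inner_diff_left inner_diff_right inner_commute field_simps\<close>)
  show "pdy n p = (cos (\<phi> p) / sin (\<phi> p)) *\<^sub>R pdy r p - (1 / sin (\<phi> p)) *\<^sub>R pdx r p"
    by (rule frame_eqI[OF p]) (use fundamental_forms[OF p] frame_derivatives_inner[OF p] sin_nonzero[OF p]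
        sin_cos_squared_add3[of "\<phi> p"] in \<open>simp_all add: inner_diff_left inner_diff_right inner_commute field_simps\<close>)
qed

text \<open>Expanding a single factor by the Weingarten equations leaves only inner products that
  are already known.\<close>

lemma pdx_n_norm: "p \<in> U \<Longrightarrow> pdx n p \<bullet> pdx n p = 1"
  and pdx_n_pdy_n: "p \<in> U \<Longrightarrow> pdx n p \<bullet> pdy n p = - cos (\<phi> p)"
proof -
  assume p: "p \<in> U"
  show "pdx n p \<bullet> pdx n p = 1"
    using frame_derivatives_inner[OF p] sin_nonzero[OF p]
    by (subst (2) weingarten(1)[OF p]) (simp add: inner_diff_right)
  show "pdx n p \<bullet> pdy n p = - cos (\<phi> p)"
    using frame_derivatives_inner[OF p] sin_nonzero[OF p]
    by (subst weingarten(2)[OF p]) (simp add: inner_diff_right)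
qed

text \<open>The pure second derivatives of \<open>r\<close> have no normal part, and their
  tangential parts are the Christoffel terms, proportional to the derivatives of \<open>n\<close>;
  hence this compact form.\<close>

lemma gauss:
  assumes p: "p \<in> U"
  shows "pdx (pdx r) p = pdx \<phi> p *\<^sub>R pdx n p" "pdy (pdy r) p = pdy \<phi> p *\<^sub>R pdy n p"
    "pdy (pdx r) p = sin (\<phi> p) *\<^sub>R n p"
  by (rule frame_eqI[OF p]; use fundamental_forms[OF p] frame_derivatives_inner[OF p] in
      \<open>simp add: inner_commute\<close>)+

lemma sine_gordon:
  assumes p: "p \<in> U"
  shows "pdy (pdx \<phi>) p = sin (\<phi> p)" "pdx (pdy \<phi>) p = sin (\<phi> p)"
proof -
  \<comment> \<open>Differentiates \<open>pdx (pdx r) \<bullet> pdy r\<close> in y. The third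
    derivative of \<open>r\<close> is computed in the other order from \<open>pdy (pdx r)\<close>, a
    multiple of \<open>n\<close>; the terms with cos \<phi> and both first derivatives of \<phi>
    then cancel, and one factor sin \<phi> can be divided out.\<close>
  have "pdx (pdx r) p \<bullet> pdy (pdy r) p + pdy (pdx (pdx r)) p \<bullet> pdy r p =
      pdy (\<lambda>p. - (sin (\<phi> p) * pdx \<phi> p)) p"
    by (rule pd_inner_eq[OF p]) (auto intro!: smooth_intros simp: frame_derivatives_inner)
  also have "\<dots> = - sin (\<phi> p) * pdy (pdx \<phi>) p - cos (\<phi> p) * pdy \<phi> p * pdx \<phi> p"
    using p by (simp add: pd_minus pd_mult pd_sin_phi differentiable smooth_derivatives smooth_on_mult open_U)
  also have "pdy (pdx (pdx r)) p = pdx (pdy (pdx r)) p"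
    by (simp add: mixed_partials[OF p smooth_derivatives(1)])
  also have "\<dots> = pdx (\<lambda>p. sin (\<phi> p) *\<^sub>R n p) p"
    using p by (intro pd_smooth_cong(1)[OF open_U]) (auto intro!: smooth_intros simp: gauss)
  also have "\<dots> = sin (\<phi> p) *\<^sub>R pdx n p + (cos (\<phi> p) * pdx \<phi> p) *\<^sub>R n p"
    using p by (simp add: pd_scaleR pd_sin_phi differentiable smooth_derivatives smooth)
  finally have "sin (\<phi> p) * pdy (pdx \<phi>) p = sin (\<phi> p) * sin (\<phi> p)"
    using p by (auto simp: gauss pdx_n_pdy_n inner_add_left frame_derivatives_inner fundamental_forms algebra_simps)
  then show *: "pdy (pdx \<phi>) p = sin (\<phi> p)"
    using sin_nonzero[OF p] by simp
  then show "pdx (pdy \<phi>) p = sin (\<phi> p)"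
    by (simp add: mixed_partials[OF p smooth(1)])
qed

text \<open>Obtained by differentiating the inner products of \<open>pdx n\<close> with the frame.
  The second equation says that every component of \<open>n\<close> solves the same linear equation
  as \<Psi>.\<close>

lemma normal_second_derivatives:
  assumes p: "p \<in> U"
  shows "pdx (pdx n) p = - n p - pdx \<phi> p *\<^sub>R pdx r p" "pdy (pdx n) p = cos (\<phi> p) *\<^sub>R n p"
proof -
  note eqs = pd_inner_eq[OF p smooth_derivatives(3) smooth(3) smooth_on_const frame_derivatives_inner(1)]
    pd_inner_eq[OF p smooth_derivatives(3) smooth_derivatives(1) smooth_on_const frame_derivatives_inner(3)]
  have eq: "pdx n p \<bullet> pdx (pdy r) p + pdx (pdx n) p \<bullet> pdy r p = pdx (\<lambda>p. - sin (\<phi> p)) p"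
    "pdx n p \<bullet> pdy (pdy r) p + pdy (pdx n) p \<bullet> pdy r p = pdy (\<lambda>p. - sin (\<phi> p)) p"
    using pd_inner_eq[OF p smooth_derivatives(3) smooth_derivatives(2) smooth_on_minus[OF open_U smooth_derivatives(9)] frame_derivatives_inner(4)]
    by auto
  have eq': "pdx (\<lambda>p. - sin (\<phi> p)) p = - cos (\<phi> p) * pdx \<phi> p"
    "pdy (\<lambda>p. - sin (\<phi> p)) p = - cos (\<phi> p) * pdy \<phi> p"
    using p by (simp_all add: pd_minus pd_sin_phi differentiable smooth_derivatives)
  note simps = inner_diff_left gauss[OF p] pd_const pdx_n_norm[OF p] pdx_n_pdy_n[OF p]
    frame_derivatives_inner[OF p] fundamental_forms[OF p] mixed_partials[OF p smooth(2)]
  show "pdx (pdx n) p = - n p - pdx \<phi> p *\<^sub>R pdx r p"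
    by (rule frame_eqI[OF p]) (use eqs eq[unfolded eq'] in \<open>simp_all add: simps inner_commute[of "pdx r p" "n p"]\<close>)
  show "pdy (pdx n) p = cos (\<phi> p) *\<^sub>R n p"
    by (rule frame_eqI[OF p]) (use eqs eq[unfolded eq'] in \<open>simp_all add: simps inner_commute[of "pdx r p" "n p"]\<close>)
qed

end

section \<open>The quadratures and the inverse recursion operator\<close>

locale pseudospherical_solution = pseudospherical +
  fixes \<Psi> :: "real \<times> real \<Rightarrow> real"
  assumes \<Psi>: "\<Psi> \<in> lin_solutions U \<phi>"
begin

lemma smooth_Psi: "smooth_on U \<Psi>"
  using \<Psi> by (simp add: lin_solutions_def)

lemma Psi_mixed:
  assumes p: "p \<in> U"
  shows "pdy (pdx \<Psi>) p = \<Psi> p * cos (\<phi> p)" "pdx (pdy \<Psi>) p = \<Psi> p * cos (\<phi> p)"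
    "pdx (pdy (pdy \<Psi>)) p = pdy \<Psi> p * cos (\<phi> p) - \<Psi> p * sin (\<phi> p) * pdy \<phi> p"
proof -
  have *: "pdy (pdx \<Psi>) p = \<Psi> p * cos (\<phi> p)" "pdx (pdy \<Psi>) p = \<Psi> p * cos (\<phi> p)" if "p \<in> U" for p
    using \<Psi> that by (simp_all add: lin_solutions_def mixed_partials smooth_Psi)
  then show "pdy (pdx \<Psi>) p = \<Psi> p * cos (\<phi> p)" "pdx (pdy \<Psi>) p = \<Psi> p * cos (\<phi> p)"
    using p by auto
  \<comment> \<open>The third derivative is reduced to lower order by moving the x-derivative inside
    and differentiating the linear equation in y.\<close>
  have "pdx (pdy (pdy \<Psi>)) p = pdy (pdx (pdy \<Psi>)) p"
    by (intro mixed_partials p smooth_on_pdy smooth_Psi)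
  also have "\<dots> = pdy (\<lambda>p. \<Psi> p * cos (\<phi> p)) p"
    by (rule pd_smooth_cong[OF open_U _ p]) (auto intro!: smooth_intros smooth_Psi simp: *)
  also have "\<dots> = pdy \<Psi> p * cos (\<phi> p) - \<Psi> p * sin (\<phi> p) * pdy \<phi> p"
    using p by (simp add: pd_mult pd_cos_phi differentiable smooth_derivatives smooth_Psi)
  finally show "pdx (pdy (pdy \<Psi>)) p = pdy \<Psi> p * cos (\<phi> p) - \<Psi> p * sin (\<phi> p) * pdy \<phi> p" .
qed

section \<open>Scalar factors of the quadratures and compatibility\<close>

definition "\<alpha> p = pdx \<phi> p / sin (\<phi> p) * pdy \<Psi> p - \<Psi> p"
definition "\<beta> p = pdy \<phi> p * (cos (\<phi> p) / sin (\<phi> p)) * pdy \<Psi> p - pdy (pdy \<Psi>) p"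

lemma quad_x_eq: "quad_x \<phi> r \<Psi> = (\<lambda>p. (\<alpha> p / sin (\<phi> p)) *\<^sub>R pdy r p)"
  and quad_y_eq: "quad_y \<phi> r \<Psi> = (\<lambda>p. (\<beta> p / sin (\<phi> p)) *\<^sub>R pdx r p)"
  by (auto simp: quad_x_def quad_y_def \<alpha>_def \<beta>_def cot_def divide_inverse)

lemma smooth_\<alpha>: "smooth_on U \<alpha>" and smooth_\<beta>: "smooth_on U \<beta>"
  unfolding \<alpha>_def[abs_def] \<beta>_def[abs_def]
  by (intro smooth_intros smooth_Psi sin_nonzero; assumption)+

lemma smooth_quad: "smooth_on U (quad_x \<phi> r \<Psi>)" "smooth_on U (quad_y \<phi> r \<Psi>)"
  unfolding quad_x_eq quad_y_eq
  by (intro smooth_intros smooth_\<alpha> smooth_\<beta> sin_nonzero; assumption)+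

text \<open>The sine-Gordon equation turns the term with the mixed derivative of \<phi> into
  \<open>pdy \<Psi> p\<close>, which cancels the last term; what remains is a multiple of
  \<beta>.\<close>

lemma pdy_\<alpha>:
  assumes p: "p \<in> U"
  shows "pdy \<alpha> p = - \<beta> p * pdx \<phi> p / sin (\<phi> p)"
proof -
  have d: "(\<lambda>p. pdx \<phi> p / sin (\<phi> p)) differentiable at p"
    by (rule differentiable[OF _ p]) (intro smooth_intros sin_nonzero)
  have d2: "(\<lambda>p. pdx \<phi> p / sin (\<phi> p) * pdy \<Psi> p) differentiable at p"
    by (rule differentiable[OF _ p]) (intro smooth_intros smooth_Psi sin_nonzero)
  have d3: "pdx \<phi> differentiable at p" "(\<lambda>p. sin (\<phi> p)) differentiable at p"
    "\<Psi> differentiable at p" "pdy \<Psi> differentiable at p"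
    by (rule differentiable[OF _ p], intro smooth_intros smooth_Psi)+
  have "pdy \<alpha> p = pdx \<phi> p / sin (\<phi> p) * pdy (pdy \<Psi>) p
      + ((pdy (pdx \<phi>) p * sin (\<phi> p) - pdx \<phi> p * (cos (\<phi> p) * pdy \<phi> p)) / (sin (\<phi> p))\<^sup>2) * pdy \<Psi> p - pdy \<Psi> p"
    unfolding \<alpha>_def[abs_def]
    by (simp only: pd_diff[OF d2 d3(3)] pd_mult[OF d d3(4)] pd_divide[OF d3(1,2) sin_nonzero[OF p]] pd_sin_phi p)
  then show ?thesis
    using sin_nonzero[OF p] by (simp add: \<beta>_def sine_gordon[OF p] field_simps power2_eq_square)
qed

text \<open>The counterpart of the preceding identity: the term cos \<phi> times
  \<open>pdy \<Psi> p\<close> coming from sine-Gordon cancels the one in the third derivative of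
  \<Psi>.\<close>

lemma pdx_\<beta>:
  assumes p: "p \<in> U"
  shows "pdx \<beta> p = - \<alpha> p * pdy \<phi> p / sin (\<phi> p)"
proof -
  have d1: "(\<lambda>p. pdy \<phi> p * (cos (\<phi> p) / sin (\<phi> p)) * pdy \<Psi> p) differentiable at p"
    by (rule differentiable[OF _ p]) (intro smooth_intros smooth_Psi sin_nonzero)
  have d2: "(\<lambda>p. pdy \<phi> p * (cos (\<phi> p) / sin (\<phi> p))) differentiable at p"
    by (rule differentiable[OF _ p]) (intro smooth_intros smooth_Psi sin_nonzero)
  have d3: "(\<lambda>p. cos (\<phi> p) / sin (\<phi> p)) differentiable at p"
    by (rule differentiable[OF _ p]) (intro smooth_intros smooth_Psi sin_nonzero)
  have d4: "pdy \<phi> differentiable at p" "(\<lambda>p. sin (\<phi> p)) differentiable at p" "(\<lambda>p. cos (\<phi> p)) differentiable at p"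
    "pdy \<Psi> differentiable at p" "pdy (pdy \<Psi>) differentiable at p"
    by (rule differentiable[OF _ p], intro smooth_intros smooth_Psi)+
  have "pdx \<beta> p = pdy \<phi> p * (cos (\<phi> p) / sin (\<phi> p)) * pdx (pdy \<Psi>) p
      + (pdy \<phi> p * ((- sin (\<phi> p) * pdx \<phi> p * sin (\<phi> p) - cos (\<phi> p) * (cos (\<phi> p) * pdx \<phi> p)) / (sin (\<phi> p))\<^sup>2)
        + pdx (pdy \<phi>) p * (cos (\<phi> p) / sin (\<phi> p))) * pdy \<Psi> p - pdx (pdy (pdy \<Psi>)) p"
    unfolding \<beta>_def[abs_def]
    by (simp only: pd_diff[OF d1 d4(5)] pd_mult[OF d2 d4(4)] pd_mult[OF d4(1) d3]
        pd_divide[OF d4(3,2) sin_nonzero[OF p]] pd_sin_phi pd_cos_phi p)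
  also have "- sin (\<phi> p) * pdx \<phi> p * sin (\<phi> p) - cos (\<phi> p) * (cos (\<phi> p) * pdx \<phi> p)
      = - pdx \<phi> p"
    using sin_cos_squared_add3[of "\<phi> p"] by algebra
  finally have "pdx \<beta> p = pdy \<phi> p * (cos (\<phi> p) * cos (\<phi> p)) / sin (\<phi> p) * \<Psi> p
      - pdy \<phi> p * pdx \<phi> p / (sin (\<phi> p) * sin (\<phi> p)) * pdy \<Psi> p + \<Psi> p * sin (\<phi> p) * pdy \<phi> p"
    using sin_nonzero[OF p] by (simp add: sine_gordon[OF p] Psi_mixed[OF p] power2_eq_square algebra_simps)
  \<comment> \<open>After this replacement the two terms in \<Psi> combine into a single one over
    sin \<phi>.\<close>
  also have "cos (\<phi> p) * cos (\<phi> p) = 1 - sin (\<phi> p) * sin (\<phi> p)"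
    using sin_cos_squared_add3[of "\<phi> p"] by linarith
  also have "pdy \<phi> p * (1 - sin (\<phi> p) * sin (\<phi> p)) / sin (\<phi> p) * \<Psi> p
      - pdy \<phi> p * pdx \<phi> p / (sin (\<phi> p) * sin (\<phi> p)) * pdy \<Psi> p + \<Psi> p * sin (\<phi> p) * pdy \<phi> p
      = - \<alpha> p * pdy \<phi> p / sin (\<phi> p)"
    using sin_nonzero[OF p] by (simp add: \<alpha>_def field_simps)
  finally show ?thesis .
qed

lemma compatibility:
  assumes p: "p \<in> U"
  shows "pdy (quad_x \<phi> r \<Psi>) p = pdx (quad_y \<phi> r \<Psi>) p"
proof -
  have d: "\<alpha> differentiable at p" "\<beta> differentiable at p" "(\<lambda>p. sin (\<phi> p)) differentiable at p"
    "pdx r differentiable at p" "pdy r differentiable at p"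
    by (rule differentiable[OF _ p], intro smooth_intros smooth_\<alpha> smooth_\<beta>)+
  have d': "(\<lambda>p. \<alpha> p / sin (\<phi> p)) differentiable at p" "(\<lambda>p. \<beta> p / sin (\<phi> p)) differentiable at p"
    by (rule differentiable[OF _ p], intro smooth_intros smooth_\<alpha> smooth_\<beta> sin_nonzero, assumption)+
  have "pdy (quad_x \<phi> r \<Psi>) p = (\<alpha> p / sin (\<phi> p)) *\<^sub>R pdy (pdy r) p +
      ((pdy \<alpha> p * sin (\<phi> p) - \<alpha> p * (cos (\<phi> p) * pdy \<phi> p)) / (sin (\<phi> p))\<^sup>2) *\<^sub>R pdy r p"
    unfolding quad_x_eq
    by (simp only: pd_scaleR[OF d'(1) d(5)] pd_divide[OF d(1,3) sin_nonzero[OF p]] pd_sin_phi p)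
  \<comment> \<open>By the Gauss and Weingarten equations the second derivative of \<open>r\<close>
    contributes a term along \<open>pdy r p\<close> that cancels the derivative of the
    denominator.\<close>
  also have "\<dots> = (pdy \<alpha> p / sin (\<phi> p)) *\<^sub>R pdy r p - (\<alpha> p * pdy \<phi> p / (sin (\<phi> p))\<^sup>2) *\<^sub>R pdx r p"
    using sin_nonzero[OF p]
    by (simp add: gauss[OF p] weingarten[OF p] scaleR_diff_right diff_divide_distrib scaleR_diff_left power2_eq_square ac_simps)
  \<comment> \<open>The derivative identities for \<alpha> and \<beta> exchange the roles of the two
    terms.\<close>
  also have "\<dots> = (pdx \<beta> p / sin (\<phi> p)) *\<^sub>R pdx r p - (\<beta> p * pdx \<phi> p / (sin (\<phi> p))\<^sup>2) *\<^sub>R pdy r p"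
    by (simp add: pdy_\<alpha>[OF p] pdx_\<beta>[OF p] power2_eq_square)
  also have "\<dots> = (\<beta> p / sin (\<phi> p)) *\<^sub>R pdx (pdx r) p +
      ((pdx \<beta> p * sin (\<phi> p) - \<beta> p * (cos (\<phi> p) * pdx \<phi> p)) / (sin (\<phi> p))\<^sup>2) *\<^sub>R pdx r p"
    using sin_nonzero[OF p]
    by (simp add: gauss[OF p] weingarten[OF p] scaleR_diff_right diff_divide_distrib scaleR_diff_left power2_eq_square ac_simps)
  also have "\<dots> = pdx (quad_y \<phi> r \<Psi>) p"
    unfolding quad_y_eq
    by (simp only: pd_scaleR[OF d'(2) d(4)] pd_divide[OF d(2,3) sin_nonzero[OF p]] pd_sin_phi p)
  finally show ?thesis .
qed

lemma quadrature_solutions_nonempty: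
  assumes "simply_connected U"
  shows "quadrature_solutions U \<phi> r \<Psi> \<noteq> {}"
proof -
  obtain F where F: "\<And>p. p \<in> U \<Longrightarrow>
      (F has_derivative (\<lambda>h. fst h *\<^sub>R quad_x \<phi> r \<Psi> p + snd h *\<^sub>R quad_y \<phi> r \<Psi> p)) (at p)"
    using closed_form_exact[OF open_U assms smooth_quad compatibility] by blast
  have "smooth_on U F"
    using smooth_on_of_smooth_partials[OF open_U F smooth_quad] .
  moreover have "pdx F p = quad_x \<phi> r \<Psi> p \<and> pdy F p = quad_y \<phi> r \<Psi> p" if "p \<in> U" for p
    using pd_eqI[OF F[OF that]] by simp
  ultimately show ?thesis
    by (auto simp: quadrature_solutions_def)
qed

text \<open>The quotient corrects \<open>pdx r \<bullet> q\<close> to a recursion potential: these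
  derivatives are exactly opposite to the inner products of \<open>pdx r\<close> with the two
  quadratures.\<close>

lemma pd_Psi_y_div_sin:
  assumes p: "p \<in> U"
  shows "pdx (\<lambda>p. pdy \<Psi> p / sin (\<phi> p)) p = - (cos (\<phi> p) / sin (\<phi> p)) * \<alpha> p"
    "pdy (\<lambda>p. pdy \<Psi> p / sin (\<phi> p)) p = - \<beta> p / sin (\<phi> p)"
proof -
  have d: "pdy \<Psi> differentiable at p" "(\<lambda>p. sin (\<phi> p)) differentiable at p"
    by (rule differentiable[OF _ p], intro smooth_intros smooth_Psi)+
  show "pdx (\<lambda>p. pdy \<Psi> p / sin (\<phi> p)) p = - (cos (\<phi> p) / sin (\<phi> p)) * \<alpha> p"
    "pdy (\<lambda>p. pdy \<Psi> p / sin (\<phi> p)) p = - \<beta> p / sin (\<phi> p)"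
    unfolding pd_divide[OF d sin_nonzero[OF p]] pd_sin_phi[OF p]
    using sin_nonzero[OF p]
    by (simp_all add: \<alpha>_def \<beta>_def Psi_mixed[OF p] field_simps power2_eq_square)
qed

section \<open>Correspondence between solutions of the quadratures and values of the inverse\<close>

lemma quadrature_gives_inverse:
  assumes q: "q \<in> quadrature_solutions U \<phi> r \<Psi>" and \<Phi>: "\<And>p. p \<in> U \<Longrightarrow> \<Phi> p = n p \<bullet> q p"
  shows "\<Phi> \<in> recursion_plus_id_inverse U \<phi> \<Psi>"
proof -
  have sq: "smooth_on U q"
    and qx: "\<And>p. p \<in> U \<Longrightarrow> pdx q p = (\<alpha> p / sin (\<phi> p)) *\<^sub>R pdy r p"
    and qy: "\<And>p. p \<in> U \<Longrightarrow> pdy q p = (\<beta> p / sin (\<phi> p)) *\<^sub>R pdx r p"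
    using q by (auto simp: quadrature_solutions_def quad_x_eq quad_y_eq)
  note dq = differentiable[OF sq]
  have s\<Phi>: "smooth_on U \<Phi>"
    by (rule smooth_on_cong[OF open_U, of "\<lambda>p. n p \<bullet> q p"]) (use \<Phi> in \<open>auto intro!: smooth_intros sq\<close>)
  have snq: "smooth_on U (\<lambda>p. n p \<bullet> q p)" "smooth_on U (\<lambda>p. pdx n p \<bullet> q p)"
    by (intro smooth_intros sq)+
  \<comment> \<open>The derivative of \<open>q\<close> drops out because it is tangent to the
    surface.\<close>
  have \<Phi>x: "pdx \<Phi> p = pdx n p \<bullet> q p" if p: "p \<in> U" for p
  proof -
    have "pdx \<Phi> p = pdx (\<lambda>p. n p \<bullet> q p) p"
      by (rule pd_smooth_cong[OF open_U snq(1) p]) (simp add: \<Phi>)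
    then show ?thesis
      using p by (simp add: pd_inner differentiable smooth dq qx fundamental_forms)
  qed
  \<comment> \<open>In y, \<open>pdx n\<close> is orthogonal to the direction \<open>pdx r\<close>
    of \<open>pdy q\<close>, so only \<open>pdy (pdx n)\<close> acts on \<open>q\<close>. In x, the
    inner product of \<open>pdx n\<close> with \<open>pdx q\<close> equals minus \<alpha>, which
    supplies the terms in \<Psi>.\<close>
  have \<Phi>xy: "pdy (pdx \<Phi>) p = \<Phi> p * cos (\<phi> p)"
    and \<Phi>xx: "pdx (pdx \<Phi>) p = \<Psi> p - pdx \<phi> p * (pdx r p \<bullet> q p + pdy \<Psi> p / sin (\<phi> p)) - \<Phi> p"
    if p: "p \<in> U" for p
  proof -
    have "pdy (pdx \<Phi>) p = pdy (\<lambda>p. pdx n p \<bullet> q p) p" "pdx (pdx \<Phi>) p = pdx (\<lambda>p. pdx n p \<bullet> q p) p"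
      using pd_smooth_cong[OF open_U snq(2) p, of "pdx \<Phi>"] by (simp_all add: \<Phi>x)
    then show "pdy (pdx \<Phi>) p = \<Phi> p * cos (\<phi> p)"
      "pdx (pdx \<Phi>) p = \<Psi> p - pdx \<phi> p * (pdx r p \<bullet> q p + pdy \<Psi> p / sin (\<phi> p)) - \<Phi> p"
      using p sin_nonzero[OF p]
      by (simp_all add: pd_inner differentiable smooth_derivatives dq qx qy frame_derivatives_inner
          normal_second_derivatives \<Phi> inner_diff_left \<alpha>_def algebra_simps diff_divide_distrib)
  qed
  define Q where "Q = (\<lambda>p. pdx r p \<bullet> q p + pdy \<Psi> p / sin (\<phi> p))"
  have sQ: "smooth_on U Q"
    unfolding Q_def by (intro smooth_intros sq smooth_Psi sin_nonzero)
  have Q: "pdx Q p = pdx \<Phi> p * pdx \<phi> p \<and> pdy Q p = \<Phi> p * sin (\<phi> p)" if p: "p \<in> U" for p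
  proof -
    have d: "(\<lambda>p. pdx r p \<bullet> q p) differentiable at p" "(\<lambda>p. pdy \<Psi> p / sin (\<phi> p)) differentiable at p"
      by (rule differentiable[OF _ p], intro smooth_intros sq smooth_Psi sin_nonzero; assumption)+
    have d': "pdx r differentiable at p" "q differentiable at p"
      by (rule differentiable[OF _ p], intro smooth_intros sq)+
    show ?thesis
      unfolding Q_def pd_add[OF d] pd_inner[OF d'] pd_Psi_y_div_sin[OF p]
      using sin_nonzero[OF p]
      by (simp add: qx[OF p] qy[OF p] fundamental_forms[OF p] gauss[OF p] \<Phi>[OF p] \<Phi>x[OF p] algebra_simps)
  qed
  have "\<Phi> \<in> lin_solutions U \<phi>"
    using s\<Phi> \<Phi>xy by (simp add: lin_solutions_def)
  moreover have "(\<lambda>p. pdx (pdx \<Phi>) p + pdx \<phi> p * Q p) \<in> recursion_values U \<phi> \<Phi>"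
    using sQ Q unfolding recursion_values_def by blast
  moreover have "\<forall>p\<in>U. \<Psi> p = (pdx (pdx \<Phi>) p + pdx \<phi> p * Q p) + \<Phi> p"
    by (simp add: \<Phi>xx Q_def)
  ultimately show ?thesis
    unfolding recursion_plus_id_inverse_def by (intro CollectI conjI bexI)
qed

lemma inverse_gives_quadrature:
  assumes "\<Phi> \<in> recursion_plus_id_inverse U \<phi> \<Psi>"
  obtains q where "q \<in> quadrature_solutions U \<phi> r \<Psi>" "\<And>p. p \<in> U \<Longrightarrow> \<Phi> p = n p \<bullet> q p"
proof -
  obtain Q where s\<Phi>: "smooth_on U \<Phi>" and \<Phi>xy: "\<And>p. p \<in> U \<Longrightarrow> pdy (pdx \<Phi>) p = \<Phi> p * cos (\<phi> p)"
    and sQ: "smooth_on U Q" and Qx: "\<And>p. p \<in> U \<Longrightarrow> pdx Q p = pdx \<Phi> p * pdx \<phi> p"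
    and Qy: "\<And>p. p \<in> U \<Longrightarrow> pdy Q p = \<Phi> p * sin (\<phi> p)"
    and \<Psi>_eq: "\<And>p. p \<in> U \<Longrightarrow> \<Psi> p = pdx (pdx \<Phi>) p + pdx \<phi> p * Q p + \<Phi> p"
    using assms by (auto simp: recursion_plus_id_inverse_def lin_solutions_def recursion_values_def)
  \<comment> \<open>The coefficient of \<open>pdx r\<close> in the vector to be built, forced by the
    form of the potential in the converse direction.\<close>
  define s where "s = (\<lambda>p. Q p - pdy \<Psi> p / sin (\<phi> p))"
  have ss: "smooth_on U s"
    unfolding s_def by (intro smooth_intros sQ smooth_Psi sin_nonzero)
  have sx: "pdx s p = pdx \<Phi> p * pdx \<phi> p + (cos (\<phi> p) / sin (\<phi> p)) * \<alpha> p"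
    and sy: "pdy s p = \<Phi> p * sin (\<phi> p) + \<beta> p / sin (\<phi> p)" if p: "p \<in> U" for p
  proof -
    have d: "Q differentiable at p" "(\<lambda>p. pdy \<Psi> p / sin (\<phi> p)) differentiable at p"
      by (rule differentiable[OF _ p], intro smooth_intros sQ smooth_Psi sin_nonzero; assumption)+
    show "pdx s p = pdx \<Phi> p * pdx \<phi> p + (cos (\<phi> p) / sin (\<phi> p)) * \<alpha> p"
      "pdy s p = \<Phi> p * sin (\<phi> p) + \<beta> p / sin (\<phi> p)"
      unfolding s_def pd_diff[OF d] pd_Psi_y_div_sin[OF p] Qx[OF p] Qy[OF p] by simp_all
  qed
  \<comment> \<open>The defining relation is differentiated in y, with the third derivative of
    \<Phi> reduced by its linear equation. This is what makes the normal part of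
    \<open>pdy q\<close> vanish below.\<close>
  have \<Psi>y: "pdy \<Psi> p = pdy \<Phi> p + cos (\<phi> p) * pdx \<Phi> p + sin (\<phi> p) * Q p" if p: "p \<in> U" for p
  proof -
    have d: "pdx (pdx \<Phi>) differentiable at p" "(\<lambda>p. pdx \<phi> p * Q p) differentiable at p"
      "(\<lambda>p. pdx (pdx \<Phi>) p + pdx \<phi> p * Q p) differentiable at p" "\<Phi> differentiable at p"
      "pdx \<phi> differentiable at p" "Q differentiable at p"
      by (rule differentiable[OF _ p], intro smooth_intros s\<Phi> sQ)+
    have "pdy \<Psi> p = pdy (\<lambda>p. pdx (pdx \<Phi>) p + pdx \<phi> p * Q p + \<Phi> p) p"
      by (rule pd_smooth_cong[OF open_U _ p]) (use \<Psi>_eq in \<open>auto intro!: smooth_intros s\<Phi> sQ\<close>)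
    also have "\<dots> = pdy (pdx (pdx \<Phi>)) p + (pdx \<phi> p * pdy Q p + pdy (pdx \<phi>) p * Q p) + pdy \<Phi> p"
      unfolding pd_add[OF d(3,4)] pd_add[OF d(1,2)] pd_mult[OF d(5,6)] ..
    also have "pdy (pdx (pdx \<Phi>)) p = pdx (pdy (pdx \<Phi>)) p"
      by (rule mixed_partials[symmetric, OF p]) (intro smooth_intros s\<Phi>)
    also have "\<dots> = pdx (\<lambda>p. \<Phi> p * cos (\<phi> p)) p"
      by (rule pd_smooth_cong[OF open_U _ p]) (auto intro!: smooth_intros s\<Phi> simp: \<Phi>xy)
    also have "\<dots> = pdx \<Phi> p * cos (\<phi> p) - \<Phi> p * sin (\<phi> p) * pdx \<phi> p"
      using p by (simp add: pd_mult pd_cos_phi differentiable smooth_derivatives s\<Phi>)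
    finally show ?thesis
      by (simp add: Qy[OF p] sine_gordon[OF p] algebra_simps)
  qed
  define q where "q = (\<lambda>p. \<Phi> p *\<^sub>R n p + pdx \<Phi> p *\<^sub>R pdx n p + s p *\<^sub>R pdx r p)"
  have sq: "smooth_on U q"
    unfolding q_def by (intro smooth_intros s\<Phi> ss)
  have "pdx q p = quad_x \<phi> r \<Psi> p \<and> pdy q p = quad_y \<phi> r \<Psi> p" if p: "p \<in> U" for p
  proof -
    have d: "\<Phi> differentiable at p" "pdx \<Phi> differentiable at p" "s differentiable at p"
      "n differentiable at p" "pdx n differentiable at p" "pdx r differentiable at p"
      by (rule differentiable[OF _ p], intro smooth_intros s\<Phi> ss)+
    have d': "(\<lambda>p. \<Phi> p *\<^sub>R n p) differentiable at p" "(\<lambda>p. pdx \<Phi> p *\<^sub>R pdx n p) differentiable at p"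
      "(\<lambda>p. s p *\<^sub>R pdx r p) differentiable at p" "(\<lambda>p. \<Phi> p *\<^sub>R n p + pdx \<Phi> p *\<^sub>R pdx n p) differentiable at p"
      by (rule differentiable[OF _ p], intro smooth_intros s\<Phi> ss)+
    note pd = pd_add[OF d'(4,3)] pd_add[OF d'(1,2)] pd_scaleR[OF d(1,4)] pd_scaleR[OF d(2,5)] pd_scaleR[OF d(3,6)]
    \<comment> \<open>The normal contributions cancel, as do the terms in
      \<open>pdx \<Phi> p * pdx \<phi> p\<close> along \<open>pdx r p\<close>.\<close>
    have "pdx q p = (\<Phi> p + pdx (pdx \<Phi>) p + s p * pdx \<phi> p) *\<^sub>R pdx n p
        + (cos (\<phi> p) / sin (\<phi> p) * \<alpha> p) *\<^sub>R pdx r p"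
      unfolding q_def pd sx[OF p] normal_second_derivatives[OF p] gauss[OF p]
      by (simp add: algebra_simps)
    also have "\<Phi> p + pdx (pdx \<Phi>) p + s p * pdx \<phi> p = - \<alpha> p"
      unfolding \<alpha>_def \<Psi>_eq[OF p] s_def by (simp add: algebra_simps)
    also have "- \<alpha> p *\<^sub>R pdx n p + (cos (\<phi> p) / sin (\<phi> p) * \<alpha> p) *\<^sub>R pdx r p = quad_x \<phi> r \<Psi> p"
      unfolding weingarten[OF p] quad_x_eq by (simp add: algebra_simps)
    finally have 1: "pdx q p = quad_x \<phi> r \<Psi> p" .
    have sin_s: "sin (\<phi> p) * s p = sin (\<phi> p) * Q p - pdy \<Psi> p"
      using sin_nonzero[OF p] by (simp add: s_def right_diff_distrib)
    have "pdy q p = (pdy \<Phi> p + cos (\<phi> p) * pdx \<Phi> p + sin (\<phi> p) * s p) *\<^sub>R n p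
        + \<Phi> p *\<^sub>R (pdy n p + cos (\<phi> p) *\<^sub>R pdx n p + sin (\<phi> p) *\<^sub>R pdx r p) + (\<beta> p / sin (\<phi> p)) *\<^sub>R pdx r p"
      unfolding q_def pd sy[OF p] normal_second_derivatives[OF p] gauss[OF p] \<Phi>xy[OF p]
      by (simp add: algebra_simps)
    also have "pdy \<Phi> p + cos (\<phi> p) * pdx \<Phi> p + sin (\<phi> p) * s p = 0"
      using \<Psi>y[OF p] sin_s by simp
    \<comment> \<open>This combination vanishes since \<open>pdy n\<close> has components -cos
      \<phi> and -sin \<phi> along the orthonormal tangent vectors \<open>pdx n\<close> and
      \<open>pdx r\<close>.\<close>
    also have "pdy n p + cos (\<phi> p) *\<^sub>R pdx n p + sin (\<phi> p) *\<^sub>R pdx r p =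
        (cos (\<phi> p) * cos (\<phi> p) / sin (\<phi> p) + sin (\<phi> p) - 1 / sin (\<phi> p)) *\<^sub>R pdx r p"
      unfolding weingarten[OF p] by (simp add: algebra_simps)
    also have "cos (\<phi> p) * cos (\<phi> p) / sin (\<phi> p) + sin (\<phi> p) - 1 / sin (\<phi> p) = 0"
      using sin_nonzero[OF p] sin_cos_squared_add3[of "\<phi> p"] by (simp add: field_simps)
    finally have "pdy q p = quad_y \<phi> r \<Psi> p"
      by (simp add: quad_y_eq)
    with 1 show ?thesis ..
  qed
  with sq have "q \<in> quadrature_solutions U \<phi> r \<Psi>"
    by (simp add: quadrature_solutions_def)
  moreover have "\<Phi> p = n p \<bullet> q p" if "p \<in> U" for p
    using that frame_derivatives_inner(1)[of p]
    by (simp add: q_def inner_add_right fundamental_forms inner_commute)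
  ultimately show ?thesis
    by (rule that)
qed

end

theorem proposition7p5:
  fixes U :: "(real \<times> real) set"
    and \<phi> \<Psi> :: "real \<times> real \<Rightarrow> real"
    and r n :: "real \<times> real \<Rightarrow> real^3"
  assumes "open U" and "connected U" and "simply_connected U"
    and "dini_surface U \<phi> r n"
    and "\<Psi> \<in> lin_solutions U \<phi>"
  shows "(\<forall>p\<in>U. pdy (quad_x \<phi> r \<Psi>) p = pdx (quad_y \<phi> r \<Psi>) p) \<and>
    quadrature_solutions U \<phi> r \<Psi> \<noteq> {} \<and>
    recursion_plus_id_inverse U \<phi> \<Psi> =
      {\<Phi>. \<exists>q\<in>quadrature_solutions U \<phi> r \<Psi>. \<forall>p\<in>U. \<Phi> p = n p \<bullet> q p}"
proof -
  interpret pseudospherical_solution U \<phi> r n \<Psi>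
    using assms by unfold_locales
  have "recursion_plus_id_inverse U \<phi> \<Psi> =
      {\<Phi>. \<exists>q\<in>quadrature_solutions U \<phi> r \<Psi>. \<forall>p\<in>U. \<Phi> p = n p \<bullet> q p}"
  proof (intro equalityI subsetI CollectI)
    fix \<Phi> assume "\<Phi> \<in> recursion_plus_id_inverse U \<phi> \<Psi>"
    then show "\<exists>q\<in>quadrature_solutions U \<phi> r \<Psi>. \<forall>p\<in>U. \<Phi> p = n p \<bullet> q p"
      by (rule inverse_gives_quadrature) blast
  next
    fix \<Phi> assume "\<Phi> \<in> {\<Phi>. \<exists>q\<in>quadrature_solutions U \<phi> r \<Psi>. \<forall>p\<in>U. \<Phi> p = n p \<bullet> q p}"
    then show "\<Phi> \<in> recursion_plus_id_inverse U \<phi> \<Psi>"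
      using quadrature_gives_inverse by blast
  qed
  then show ?thesis
    using compatibility quadrature_solutions_nonempty[OF assms(3)] by blast
qed

end
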